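(* (i) For any $k\geq15$, there exist sequences $\{a_n\}$ of positive numbers, of primitive period $k$ and rank $k$, such that $F_{[k]}=F_{a_k,\dots,a_2,a_1}$ is rationally integrable and the corresponding recurrence $x_{n+2}=\frac{a_n+x_{n+1}}{x_n}$ is persistent. (ii) For any $1\le k<15$, $k\neq5$, there exist sequences $\{a_n\}$ of positive numbers, of primitive period $k$ and with rank $r_k$, such that $F_{[k]}$ is rationally integrable and the corresponding recurrence is persistent, where $r_1=1$, $r_2=2$, $r_3=3$, $r_4=4$, $r_6=6$, $r_7=3$, $r_8=4$, $r_9=5$, and $r_k=k-5$ for $10\le k\le14$. (iii) Moreover, for every $k\geq15$ (with $\{a_n\}$ of primitive period $k$ and rank $k$, $F_{[k]}$ rationally integrable and the recurrence persistent) and for every $1\le k<15$, $k\neq5$ (with $\{a_n\}$ of primitive period $k$ and rank $r_k$, $F_{[k]}$ rationally integrable and the recurrence persistent), it is possible to take positive parameters $a_1,a_2,\dots,a_k$ such that each sequence $\{x_n\}$ generated by the recurrence $x_{n+2}=\frac{a_n+x_{n+1}}{x_n}$ with positive initial conditions is either periodic, with period a multiple of $k$, or densely fills at most $k$ disjoint intervals of $\mathbb{R}^+$.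
   Context: The rank of a periodic sequence $\{a_n\}$ of primitive period $k$ is $\mathrm{Card}\{a_1,\dots,a_k\}$. For $a>0$, $F_a(x,y)=\left(y,\frac{a+y}{x}\right)$ on $Q^+=\{(x,y):x>0,y>0\}$, and $F_{[k]}=F_{a_k,\dots,a_2,a_1}:=F_{a_k}\circ\cdots\circ F_{a_2}\circ F_{a_1}$. The map $F_{[k]}$ is rationally integrable if it has a (non-constant) rational first integral, i.e. a rational function $H=P/Q$, with $P,Q$ coprime polynomials, such that $P(F_{[k]})\,Q=P\,Q(F_{[k]})$. The recurrence is persistent if for any sequence $\{x_n\}$ generated by it from positive initial conditions there exist constants $c,C>0$, depending on the initial conditions, with $c<x_n<C$ for all $n$. A sequence densely fills at most $k$ disjoint intervals if its set of values is a dense subset of a union of at most $k$ disjoint intervals. *)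

theory Defs
  imports "HOL-Analysis.Analysis" "HOL-Computational_Algebra.Computational_Algebra"
begin

(* All sequences s_1, s_2, ... are functions on nat whose value at 0 is ignored. *)

definition has_period :: "(nat \<Rightarrow> 'a) \<Rightarrow> nat \<Rightarrow> bool" where
  "has_period s p \<longleftrightarrow> p \<ge> 1 \<and> (\<forall>n\<ge>1. s (n + p) = s n)"

definition primitive_period :: "(nat \<Rightarrow> 'a) \<Rightarrow> nat \<Rightarrow> bool" where
  "primitive_period s p \<longleftrightarrow> has_period s p \<and> (\<forall>q. has_period s q \<longrightarrow> p \<le> q)"

definition pos_seq :: "(nat \<Rightarrow> real) \<Rightarrow> bool" where
  "pos_seq a \<longleftrightarrow> (\<forall>n\<ge>1. a n > 0)"

(* Meant for a sequence of primitive period k. *)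
definition seq_rank :: "(nat \<Rightarrow> 'a) \<Rightarrow> nat \<Rightarrow> nat" where
  "seq_rank s k = card (s ` {1..k})"

definition Qplus :: "(real \<times> real) set" where
  "Qplus = {(x, y). x > 0 \<and> y > 0}"

(* Only used on Qplus, which it maps into itself when a > 0. *)
definition lyness_map :: "real \<Rightarrow> real \<times> real \<Rightarrow> real \<times> real" where
  "lyness_map a = (\<lambda>(x, y). (y, (a + y) / x))"

primrec lyness_comp :: "(nat \<Rightarrow> real) \<Rightarrow> nat \<Rightarrow> real \<times> real \<Rightarrow> real \<times> real" where
  "lyness_comp a 0 = id"
| "lyness_comp a (Suc k) = lyness_map (a (Suc k)) \<circ> lyness_comp a k"

(* Bivariate polynomials are polynomials in y with coefficients in R[x]. *)
definition eval2 :: "real poly poly \<Rightarrow> real \<times> real \<Rightarrow> real" where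
  "eval2 P = (\<lambda>(x, y). poly (poly P [:y:]) x)"

(* The invariance is required at the points of Qplus only; for the maps
   lyness_comp a k with a positive this is the same as equality of rational
   functions, since Qplus is Zariski dense. *)
definition rationally_integrable :: "(real \<times> real \<Rightarrow> real \<times> real) \<Rightarrow> bool" where
  "rationally_integrable F \<longleftrightarrow>
     (\<exists>P Q :: real poly poly. Q \<noteq> 0 \<and> coprime P Q \<and>
        \<not> (\<exists>c. P = smult [:c:] Q) \<and>
        (\<forall>z\<in>Qplus. eval2 P (F z) * eval2 Q z = eval2 P z * eval2 Q (F z)))"

definition lyness_solution :: "(nat \<Rightarrow> real) \<Rightarrow> (nat \<Rightarrow> real) \<Rightarrow> bool" where
  "lyness_solution a x \<longleftrightarrow>
     x 1 > 0 \<and> x 2 > 0 \<and> (\<forall>n\<ge>1. x (n + 2) = (a n + x (n + 1)) / x n)"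

definition persistent :: "(nat \<Rightarrow> real) \<Rightarrow> bool" where
  "persistent a \<longleftrightarrow>
     (\<forall>x. lyness_solution a x \<longrightarrow> (\<exists>c C. c > 0 \<and> C > 0 \<and> (\<forall>n\<ge>1. c < x n \<and> x n < C)))"

(* Intervals are nondegenerate: with single points allowed, every sequence taking
   at most k values would qualify. *)
definition densely_fills_at_most :: "(nat \<Rightarrow> real) \<Rightarrow> nat \<Rightarrow> bool" where
  "densely_fills_at_most x k \<longleftrightarrow>
     (\<exists>\<I> :: real set set. finite \<I> \<and> card \<I> \<le> k \<and> disjoint \<I> \<and>
        (\<forall>I\<in>\<I>. is_interval I \<and> interior I \<noteq> {} \<and> I \<subseteq> {0<..}) \<and>
        x ` {1..} \<subseteq> \<Union>\<I> \<and> \<Union>\<I> \<subseteq> closure (x ` {1..}))"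

(* Since a_n = x_(n+2) x_n - x_(n+1), the primitive period of a periodic solution is
   automatically a multiple of that of a; admitting non-primitive periods would
   make the multiple-of-k clause vacuous. *)
definition periodic_or_densely_filling :: "(nat \<Rightarrow> real) \<Rightarrow> nat \<Rightarrow> bool" where
  "periodic_or_densely_filling a k \<longleftrightarrow>
     (\<forall>x. lyness_solution a x \<longrightarrow>
        (\<exists>p. primitive_period x p \<and> k dvd p) \<or> densely_fills_at_most x k)"

(* The value at k = 5 (and outside 1..14) is never used. *)
definition small_rank :: "nat \<Rightarrow> nat" where
  "small_rank k =
     (if k = 1 then 1 else if k = 2 then 2 else if k = 3 then 3 else if k = 4 then 4
      else if k = 6 then 6 else if k = 7 then 3 else if k = 8 then 4 else if k = 9 then 5
      else k - 5)"

definition good_parameters :: "(nat \<Rightarrow> real) \<Rightarrow> nat \<Rightarrow> nat \<Rightarrow> bool" where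
  "good_parameters a k r \<longleftrightarrow>
     pos_seq a \<and> primitive_period a k \<and> seq_rank a k = r \<and>
     rationally_integrable (lyness_comp a k) \<and> persistent a"

end

theory Submission imports Defs begin

text \<open>
  The third and fourth conjuncts imply the first two, so for each period \<open>k\<close> one list
  of parameters is exhibited. What makes a list good is a single algebraic fact: the
  composition \<open>F\<close> of its Lyness maps preserves a function
  \[ V(x,y) = Ax + By + C\,x/y + D\,y/x + E/y + G/x + H/(xy) \]
  with \<open>A, B, E, G > 0\<close> and \<open>C, D, H \<ge> 0\<close>. Clearing denominators gives the rational first
  integral, and the four positive coefficients confine every orbit to a compact set, which gives
  persistence (\<open>rationally_integrable_steps\<close>, \<open>persistent_cyc\<close>).

  The dichotomy also follows from \<open>V\<close>. In the coordinates \<open>log x, log y\<close> the function \<open>V\<close> is a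
  positive combination of exponentials of linear forms, hence strictly convex and coercive, and
  every Lyness map preserves area. A level set of \<open>V\<close> other than the minimum is a closed curve,
  and it is a periodic orbit \<open>d\<close> of the Hamiltonian field of \<open>V\<close>
  (\<open>periodic_orbit\<close>). An area-preserving map that preserves \<open>V\<close> preserves this field,
  so uniqueness for the differential equation turns it into a translation of time:
  \<open>F (d t) = d (t + \<tau>)\<close> (\<open>invariant_level_rotation\<close>). If \<open>\<tau>\<close> is a rational multiple of the period
  of \<open>d\<close>, the orbit is periodic; otherwise Kronecker's theorem makes it dense in the curve. The
  values \<open>x\<^sub>n\<close> with \<open>n\<close> in a fixed residue class modulo \<open>k\<close> are then dense in a coordinate
  projection of a closed curve, that is in an interval, and the connected components of the union
  of these \<open>k\<close> intervals are the required intervals (\<open>periodic_or_densely_filling_cyc\<close>).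

  Two sources supply lists with an invariant. Every sequence of parameters of period
  \<open>1\<close>, \<open>2\<close>, \<open>3\<close> or \<open>6\<close> has one (\<open>hex_step\<close>). And the substitution \<open>x\<^sub>n = \<lambda>\<^sub>n u\<^sub>n\<close> with
  \<open>\<lambda>\<^sub>n\<^sub>+\<^sub>2 = \<lambda>\<^sub>n\<^sub>+\<^sub>1 / \<lambda>\<^sub>n\<close> turns the globally 5-periodic recurrence with parameter \<open>1\<close> into a two-parameter
  family of blocks of five parameters whose composition is merely a scaling of the two coordinates
  (\<open>steps_block\<close>). Blocks whose scalings cancel can be put in front of any list without changing
  its composition. With at least three blocks all parameters can be made distinct, which gives rank
  \<open>k\<close> for all \<open>k \<ge> 15\<close>; the ranks below \<open>15\<close> come from at most two blocks and suitable
  coincidences among the parameters.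
\<close>

section \<open>Positive sums of exponentials in the plane\<close>

text \<open>
  The exponents \<open>\<plusminus>1\<close> and \<open>\<plusminus>\<i>\<close> are those of \<open>x\<close>, \<open>1/x\<close>, \<open>y\<close>, \<open>1/y\<close> in logarithmic
  coordinates. They make the sum coercive, and because they span the plane they make it strictly
  convex.
\<close>

locale positive_exp_sum =
  fixes I :: "'i set" and k :: "'i \<Rightarrow> complex" and c :: "'i \<Rightarrow> real"
  assumes fin: "finite I"
    and nonneg: "\<And>i. i \<in> I \<Longrightarrow> 0 \<le> c i"
    and directions: "\<And>u. u \<in> {1, -1, \<i>, -\<i>} \<Longrightarrow> \<exists>i\<in>I. 0 < c i \<and> k i = u"
begin

definition V :: "complex \<Rightarrow> real" where
  "V z = (\<Sum>i\<in>I. c i * exp (k i \<bullet> z))"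

definition grad :: "complex \<Rightarrow> complex" where
  "grad z = (\<Sum>i\<in>I. (c i * exp (k i \<bullet> z)) *\<^sub>R k i)"

lemma V_has_derivative: "(V has_derivative (\<lambda>v. grad z \<bullet> v)) (at z)"
proof -
  have "((\<lambda>z. \<Sum>i\<in>I. c i * exp (k i \<bullet> z)) has_derivative
      (\<lambda>v. \<Sum>i\<in>I. c i * (exp (k i \<bullet> z) * (k i \<bullet> v)))) (at z)"
    by (intro has_derivative_sum) (auto intro!: derivative_eq_intros)
  then show ?thesis
    unfolding V_def [abs_def] grad_def by (simp add: inner_sum_left mult.assoc)
qed

lemma continuous_grad: "continuous_on UNIV grad"
  unfolding grad_def [abs_def] by (intro continuous_intros)

lemma continuous_V: "continuous_on UNIV V"
  unfolding V_def [abs_def] by (intro continuous_intros)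

text \<open>
  Each exponential contributes a nonnegative term because \<open>exp\<close> is increasing, and one of the
  exponents \<open>1\<close>, \<open>\<i>\<close> separates \<open>z\<close> from \<open>w\<close>. This is the form in which strict convexity is used.
\<close>

lemma grad_strictly_monotone:
  assumes "z \<noteq> w"
  shows "0 < (grad z - grad w) \<bullet> (z - w)"
proof -
  have eq: "(grad z - grad w) \<bullet> (z - w) =
      (\<Sum>i\<in>I. c i * ((exp (k i \<bullet> z) - exp (k i \<bullet> w)) * (k i \<bullet> z - k i \<bullet> w)))"
    unfolding grad_def
    by (simp add: inner_sum_left inner_diff_right sum_subtractf [symmetric] algebra_simps)
  have nn: "0 \<le> (exp a - exp b) * (a - b)" for a b :: real
    by (cases a b rule: linorder_cases) (auto simp: mult_nonpos_nonpos)
  have pos: "0 < (exp a - exp b) * (a - b)" if "a \<noteq> b" for a b :: real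
    using that by (cases a b rule: linorder_cases) (auto simp: mult_neg_neg)
  have "Re z \<noteq> Re w \<or> Im z \<noteq> Im w" using assms by (auto simp: complex_eq_iff)
  then have "1 \<bullet> z \<noteq> 1 \<bullet> w \<or> \<i> \<bullet> z \<noteq> \<i> \<bullet> w" by (simp add: inner_complex_def)
  then obtain u where u: "u \<in> {1, \<i>}" "u \<bullet> z \<noteq> u \<bullet> w" by blast
  then obtain i where i: "i \<in> I" "0 < c i" "k i = u" using directions [of u] by auto
  show ?thesis
    unfolding eq
    by (rule sum_pos2 [OF fin i(1)])
      (use i u nn pos nonneg in \<open>auto intro!: mult_nonneg_nonneg mult_pos_pos\<close>)
qed

lemma V_coercive: "\<exists>\<mu>>0. \<forall>z. \<mu> * norm z \<le> V z"
proof -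
  have le_exp: "t \<le> exp t" for t :: real
    using exp_ge_add_one_self [of t] by linarith
  have *: "\<exists>\<mu>>0. \<forall>z. \<mu> * (u \<bullet> z) \<le> V z" if u: "u \<in> {1, -1, \<i>, -\<i>}" for u
  proof -
    obtain i where i: "i \<in> I" "0 < c i" "k i = u" using directions [OF u] by blast
    have "c i * (u \<bullet> z) \<le> V z" for z
    proof -
      have "c i * (u \<bullet> z) \<le> c i * exp (k i \<bullet> z)"
        using i le_exp [of "u \<bullet> z"] by (intro mult_left_mono) auto
      also have "\<dots> \<le> V z"
        unfolding V_def by (rule member_le_sum [OF i(1) _ fin]) (auto simp: nonneg)
      finally show ?thesis .
    qed
    with i show ?thesis by blast
  qed
  have V0: "0 \<le> V z" for z unfolding V_def by (intro sum_nonneg) (auto simp: nonneg)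
  obtain a where a: "a > 0" "\<And>z. a * (1 \<bullet> z) \<le> V z" using * [of 1] by auto
  obtain b where b: "b > 0" "\<And>z. b * ((-1) \<bullet> z) \<le> V z" using * [of "-1"] by auto
  obtain d where d: "d > 0" "\<And>z. d * (\<i> \<bullet> z) \<le> V z" using * [of "\<i>"] by auto
  obtain e where e: "e > 0" "\<And>z. e * ((-\<i>) \<bullet> z) \<le> V z" using * [of "-\<i>"] by auto
  define \<mu> where "\<mu> = Min {a, b, d, e}"
  have \<mu>: "\<mu> > 0" "\<mu> \<le> a" "\<mu> \<le> b" "\<mu> \<le> d" "\<mu> \<le> e"
    using a b d e by (auto simp: \<mu>_def)
  have le: "\<mu> * x \<le> V z" if "\<mu> \<le> r" "r * x \<le> V z" for r x z
  proof (cases "x \<ge> 0")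
    case True then show ?thesis using that mult_right_mono [of \<mu> r x] by linarith
  next
    case False then show ?thesis using \<mu>(1) V0 [of z] mult_pos_neg [of \<mu> x] by linarith
  qed
  have "\<mu> / 2 * norm z \<le> V z" for z
  proof -
    have "\<mu> * \<bar>Re z\<bar> \<le> V z" using le [OF \<mu>(2) a(2) [of z]] le [OF \<mu>(3) b(2) [of z]]
      by (cases "Re z \<ge> 0") (auto simp: inner_complex_def)
    moreover have "\<mu> * \<bar>Im z\<bar> \<le> V z" using le [OF \<mu>(4) d(2) [of z]] le [OF \<mu>(5) e(2) [of z]]
      by (cases "Im z \<ge> 0") (auto simp: inner_complex_def)
    moreover have "\<mu> * norm z \<le> \<mu> * (\<bar>Re z\<bar> + \<bar>Im z\<bar>)"
      using \<mu>(1) cmod_le [of z] by (intro mult_left_mono) auto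
    ultimately show ?thesis by (simp add: algebra_simps)
  qed
  then show ?thesis using \<mu>(1) by (intro exI [of _ "\<mu>/2"]) auto
qed

lemma bounded_sublevel: "bounded {z. V z \<le> h}"
proof -
  obtain \<mu> where \<mu>: "\<mu> > 0" "\<And>z. \<mu> * norm z \<le> V z" using V_coercive by blast
  have "norm z \<le> h / \<mu>" if "V z \<le> h" for z
    using \<mu>(1) order_trans [OF \<mu>(2) that] by (simp add: field_simps)
  then show ?thesis by (auto simp: bounded_iff)
qed

lemma minimum_exists: "\<exists>m. \<forall>z. V m \<le> V z"
proof -
  define S where "S = {z. V z \<le> V 0}"
  have "closed S" unfolding S_def
    using continuous_closed_vimage [of "{..V 0}" V] continuous_V
    by (auto simp: vimage_def continuous_on_eq_continuous_at)
  then have "compact S" using bounded_sublevel [of "V 0"] by (simp add: S_def compact_eq_bounded_closed)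
  moreover have "S \<noteq> {}" by (auto simp: S_def)
  ultimately obtain m where m: "m \<in> S" "\<forall>z\<in>S. V m \<le> V z"
    using continuous_attains_inf [of S V] continuous_on_subset [OF continuous_V] by blast
  then have "V m \<le> V z" for z by (cases "z \<in> S") (auto simp: S_def)
  then show ?thesis by blast
qed

definition centre :: complex where "centre = (SOME m. \<forall>z. V m \<le> V z)"

lemma V_centre_le: "V centre \<le> V z"
  using someI_ex [OF minimum_exists] by (simp add: centre_def)

lemma grad_centre: "grad centre = 0"
proof -
  have "(\<lambda>v. grad centre \<bullet> v) = (\<lambda>v. 0)"
    using differential_zero_maxmin [OF _ open_UNIV V_has_derivative, of centre] V_centre_le by auto
  then have "grad centre \<bullet> grad centre = 0" by meson
  then show ?thesis by simp
qed

text \<open>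
  Seen from the minimum, \<open>V\<close> increases along every ray at a positive rate. Hence level sets are
  star-shaped curves on which polar angle is a regular parameter.
\<close>

lemma grad_outward: "w \<noteq> 0 \<Longrightarrow> 0 < grad (centre + w) \<bullet> w"
  using grad_strictly_monotone [of "centre + w" centre] by (simp add: grad_centre)

lemma V_along:
  assumes "(f has_vector_derivative f') (at t)"
  shows "((\<lambda>t. V (f t)) has_real_derivative grad (f t) \<bullet> f') (at t)"
  using has_derivative_compose [OF assms [unfolded has_vector_derivative_def] V_has_derivative]
  unfolding has_field_derivative_def by (simp add: mult_commute_abs)

lemma V_radially_increasing:
  assumes "\<rho> < \<rho>'"
  shows "V (centre + exp (Complex \<rho> \<theta>)) < V (centre + exp (Complex \<rho>' \<theta>))"
proof (rule DERIV_pos_imp_increasing [OF assms])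
  fix t
  have "((\<lambda>t. Complex t \<theta>) has_vector_derivative 1) (at t)"
    by (auto simp: has_vector_derivative_complex_iff intro!: derivative_eq_intros)
  then have "((\<lambda>t. centre + exp (Complex t \<theta>)) has_vector_derivative exp (Complex t \<theta>)) (at t)"
    using field_vector_diff_chain_at [of "\<lambda>t. Complex t \<theta>" 1 t exp] DERIV_exp
    by (auto intro!: derivative_eq_intros simp: o_def)
  from V_along [OF this] grad_outward [of "exp (Complex t \<theta>)"]
  show "\<exists>y. ((\<lambda>t. V (centre + exp (Complex t \<theta>))) has_real_derivative y) (at t) \<and> 0 < y"
    by auto
qed

lemma V_centre_less:
  assumes "z \<noteq> centre"
  shows "V centre < V z"
proof -
  define w where "w = ln (z - centre)"
  have w: "z = centre + exp (Complex (Re w) (Im w))" using assms by (simp add: w_def del: Re_Ln)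
  have "V centre \<le> V (centre + exp (Complex (Re w - 1) (Im w)))" by (rule V_centre_le)
  also have "\<dots> < V z" unfolding w by (rule V_radially_increasing) simp
  finally show ?thesis .
qed

lemma radial_level_exists:
  assumes "V centre < h"
  shows "\<exists>\<rho>. V (centre + exp (Complex \<rho> \<theta>)) = h"
proof -
  define f where "f = (\<lambda>\<rho>. V (centre + exp (Complex \<rho> \<theta>)))"
  have cont: "isCont f t" for t
  proof -
    have "continuous_on UNIV f"
      unfolding f_def
      by (intro continuous_on_compose2 [OF continuous_V] continuous_intros) auto
    then show ?thesis by (simp add: continuous_on_eq_continuous_at)
  qed
  have norm_exp: "norm (exp (Complex \<rho> \<theta>)) = exp \<rho>" for \<rho> by simp
  have "continuous_on UNIV V" by (rule continuous_V)
  then have "isCont V centre" by (simp add: continuous_on_eq_continuous_at)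
  then obtain d where d: "d > 0" "\<And>z. dist z centre < d \<Longrightarrow> dist (V z) (V centre) < h - V centre"
    unfolding continuous_at_eps_delta using assms by (metis diff_gt_0_iff_gt)
  have lo: "f (ln (d/2)) \<le> h"
  proof -
    have "dist (centre + exp (Complex (ln (d/2)) \<theta>)) centre = d / 2"
      using d(1) norm_exp [of "ln (d/2)"] by (simp add: dist_norm)
    then have "dist (f (ln (d/2))) (V centre) < h - V centre" unfolding f_def using d by auto
    then show ?thesis by (simp add: dist_real_def)
  qed
  obtain \<mu> where \<mu>: "\<mu> > 0" "\<And>z. \<mu> * norm z \<le> V z" using V_coercive by blast
  define R where "R = max (d/2) (\<bar>h\<bar> / \<mu> + norm centre)"
  have R: "R > 0" "ln (d/2) \<le> ln R" using d(1) by (auto simp: R_def)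
  have hi: "h \<le> f (ln R)"
  proof -
    have "R = norm (exp (Complex (ln R) \<theta>))" using R by simp
    also have "\<dots> \<le> norm (centre + exp (Complex (ln R) \<theta>)) + norm centre"
      using norm_triangle_ineq4 [of "centre + exp (Complex (ln R) \<theta>)" centre] by simp
    finally have "\<bar>h\<bar> / \<mu> \<le> norm (centre + exp (Complex (ln R) \<theta>))"
      unfolding R_def by linarith
    then have "\<bar>h\<bar> \<le> \<mu> * norm (centre + exp (Complex (ln R) \<theta>))"
      using \<mu>(1) by (simp add: field_simps)
    then show ?thesis using \<mu>(2) [of "centre + exp (Complex (ln R) \<theta>)"] by (simp add: f_def)
  qed
  show ?thesis using IVT [OF lo hi R(2)] cont unfolding f_def by blast
qed

section \<open>Level curves as periodic Hamiltonian orbits\<close>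

text \<open>
  Points other than the minimum are written \<open>centre + exp w\<close>, so that \<open>Re w\<close> is the
  logarithm of the radius and \<open>Im w\<close> the angle. The map \<open>polar\<close> replaces the radius by the
  value of \<open>V\<close>; its inverse therefore parametrizes the level sets by angle.
\<close>

definition polar :: "complex \<Rightarrow> complex" where
  "polar w = Complex (V (centre + exp w)) (Im w)"

lemma inj_polar: "inj polar"
proof (rule injI)
  fix w w' assume eq: "polar w = polar w'"
  then have im: "Im w = Im w'" and V: "V (centre + exp w) = V (centre + exp w')"
    by (auto simp: polar_def)
  have less: "V (centre + exp a) < V (centre + exp b)" if "Re a < Re b" "Im a = Im b" for a b
    using V_radially_increasing [of "Re a" "Re b" "Im a"] that by (metis complex_surj)
  have "Re w = Re w'"
    using less [of w w'] less [of w' w] im V by fastforce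
  with im show "w = w'" by (simp add: complex_eq_iff)
qed

definition lift :: "real \<Rightarrow> real \<Rightarrow> complex" where
  "lift h \<theta> = inv polar (Complex h \<theta>)"

definition curve :: "real \<Rightarrow> real \<Rightarrow> complex" where
  "curve h \<theta> = centre + exp (lift h \<theta>)"

text \<open>
  The ratio between Hamiltonian time and angle along a level curve: a Hamiltonian motion
  \<open>q' = \<i> * grad q\<close> turns around the centre with angular velocity
  \<open>(grad q \<bullet> (q - centre)) / |q - centre|\<^sup>2\<close>.
\<close>

definition speed :: "real \<Rightarrow> real \<Rightarrow> real" where
  "speed h \<theta> = (norm (curve h \<theta> - centre))\<^sup>2 / (grad (curve h \<theta>) \<bullet> (curve h \<theta> - centre))"

lemma polar_lift:
  assumes "V centre < h"
  shows "polar (lift h \<theta>) = Complex h \<theta>"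
proof -
  obtain \<rho> where "V (centre + exp (Complex \<rho> \<theta>)) = h" using radial_level_exists [OF assms] by blast
  then have "polar (Complex \<rho> \<theta>) = Complex h \<theta>" by (simp add: polar_def)
  then show ?thesis unfolding lift_def by (metis f_inv_into_f rangeI)
qed

lemma
  assumes "V centre < h"
  shows V_curve: "V (curve h \<theta>) = h" and Im_lift: "Im (lift h \<theta>) = \<theta>"
  using polar_lift [OF assms, of \<theta>] by (auto simp: polar_def curve_def)

lemma lift_eqI: "V (centre + exp w) = h \<Longrightarrow> lift h (Im w) = w"
  unfolding lift_def using inv_f_f [OF inj_polar, of w] by (simp add: polar_def)

lemma lift_periodic:
  assumes "V centre < h"
  shows "lift h (\<theta> + 2 * pi) = lift h \<theta> + 2 * pi * \<i>"
proof -
  have "exp (lift h \<theta> + 2 * of_real pi * \<i>) = exp (lift h \<theta>)"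
    by (simp add: exp_add)
  then show ?thesis
    using lift_eqI [of "lift h \<theta> + 2 * pi * \<i>" h] V_curve [OF assms, of \<theta>] Im_lift [OF assms, of \<theta>]
    by (simp add: curve_def)
qed

lemma curve_periodic: "V centre < h \<Longrightarrow> curve h (\<theta> + 2 * pi) = curve h \<theta>"
  unfolding curve_def by (simp add: lift_periodic exp_add)

lemma curve_surj:
  assumes "V q = h" "V centre < h"
  shows "\<exists>\<theta>. q = curve h \<theta>"
proof -
  have "q \<noteq> centre" using assms by auto
  then have "q = centre + exp (ln (q - centre))" by simp
  then show ?thesis using lift_eqI [of "ln (q - centre)" h] assms(1) by (metis curve_def)
qed

lemma polar_has_derivative:
  "(polar has_derivative (\<lambda>u. Complex (grad (centre + exp w) \<bullet> (exp w * u)) (Im u))) (at w)"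
proof -
  have "((\<lambda>w. centre + exp w) has_derivative (\<lambda>u. exp w * u)) (at w)"
    by (auto intro!: derivative_eq_intros)
  from has_derivative_compose [OF this V_has_derivative]
  have "((\<lambda>w. of_real (V (centre + exp w)) + \<i> * of_real (Im w)) has_derivative
    (\<lambda>u. of_real (grad (centre + exp w) \<bullet> (exp w * u)) + \<i> * of_real (Im u))) (at w)"
    by (auto intro!: derivative_eq_intros)
  then show ?thesis unfolding polar_def [abs_def] Complex_eq .
qed

text \<open>
  The derivative of \<open>polar\<close> is triangular with diagonal entry \<open>grad \<bullet> q > 0\<close>, so the inverse
  function theorem applies; the slope on the right is the one that keeps \<open>V\<close> constant.
\<close>

lemma lift_has_vector_derivative:
  fixes \<theta> :: real
  assumes h: "V centre < h"
  defines "q \<equiv> exp (lift h \<theta>)"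
  shows "(lift h has_vector_derivative
      Complex (- (grad (centre + q) \<bullet> (\<i> * q)) / (grad (centre + q) \<bullet> q)) 1) (at \<theta>)"
proof -
  define w where "w = lift h \<theta>"
  define B where "B = grad (centre + q) \<bullet> q"
  define A where "A = grad (centre + q) \<bullet> (\<i> * q)"
  have B: "B > 0" unfolding B_def q_def by (rule grad_outward) simp
  have "(inv polar has_derivative (\<lambda>v. Complex ((Re v - A * Im v) / B) (Im v))) (at (polar w))"
  proof (rule has_derivative_inverse_strong [of UNIV w polar "inv polar"])
    show "continuous_on UNIV polar"
      by (intro continuous_at_imp_continuous_on ballI has_derivative_continuous [OF polar_has_derivative])
    show "(polar has_derivative (\<lambda>u. Complex (grad (centre + exp w) \<bullet> (exp w * u)) (Im u))) (at w)"
      by (rule polar_has_derivative)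
    have lin: "grad (centre + exp w) \<bullet> (exp w * u) = B * Re u + A * Im u" for u
      unfolding A_def B_def q_def w_def inner_complex_def by (simp add: algebra_simps)
    show "(\<lambda>u. Complex (grad (centre + exp w) \<bullet> (exp w * u)) (Im u)) \<circ>
        (\<lambda>v. Complex ((Re v - A * Im v) / B) (Im v)) = id"
      using B by (auto simp: lin fun_eq_iff complex_eq_iff)
  qed (auto simp: inj_polar)
  then have inv: "(inv polar has_derivative (\<lambda>v. Complex ((Re v - A * Im v) / B) (Im v)))
      (at (Complex h \<theta>))"
    using polar_lift [OF h] by (simp add: w_def)
  have "((\<lambda>t. Complex h t) has_derivative (\<lambda>s. Complex 0 s)) (at \<theta>)"
    by (auto simp: Complex_eq intro!: derivative_eq_intros)
  from has_derivative_compose [OF this inv]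
  show ?thesis
    unfolding lift_def [abs_def] has_vector_derivative_def A_def [symmetric] B_def [symmetric]
    by (simp add: complex_eq_iff scaleR_complex.code mult.commute)
qed

text \<open>
  A vector tangent to a level curve is orthogonal to the gradient, hence a multiple of
  \<open>\<i> * grad\<close>; the computation identifies the multiple as \<open>speed\<close>.
\<close>

lemma curve_has_vector_derivative:
  assumes h: "V centre < h"
  shows "(curve h has_vector_derivative speed h \<theta> *\<^sub>R (\<i> * grad (curve h \<theta>))) (at \<theta>)"
proof -
  define q where "q = exp (lift h \<theta>)"
  define B where "B = grad (centre + q) \<bullet> q"
  define A where "A = grad (centre + q) \<bullet> (\<i> * q)"
  have B: "B > 0" unfolding B_def q_def by (rule grad_outward) simp
  have "(curve h has_vector_derivative (Complex (- A / B) 1 * q)) (at \<theta>)"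
    using field_vector_diff_chain_at [OF lift_has_vector_derivative [OF h, of \<theta>], of exp "exp (lift h \<theta>)"]
      DERIV_exp
    unfolding curve_def [abs_def] A_def B_def q_def
    by (auto intro!: derivative_eq_intros simp: o_def)
  moreover have "Complex (- A / B) 1 * q = speed h \<theta> *\<^sub>R (\<i> * grad (curve h \<theta>))"
  proof -
    have "Complex (- A / B) 1 = (1 / B) *\<^sub>R (\<i> * grad (centre + q) * cnj q)"
      using B by (simp add: complex_eq_iff A_def B_def inner_complex_def algebra_simps)
    then have "Complex (- A / B) 1 * q = (1 / B) *\<^sub>R (\<i> * grad (centre + q) * (q * cnj q))"
      by (simp add: mult_ac)
    also have "\<dots> = ((norm q)\<^sup>2 / B) *\<^sub>R (\<i> * grad (centre + q))"
      by (simp add: complex_norm_square [symmetric] scaleR_conv_of_real mult_ac del: of_real_power)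
    finally show ?thesis by (simp add: speed_def curve_def B_def q_def)
  qed
  ultimately show ?thesis by simp
qed

lemma speed_pos: "0 < speed h \<theta>"
  using grad_outward [of "exp (lift h \<theta>)"] by (auto simp: speed_def curve_def)

lemma continuous_curve: "V centre < h \<Longrightarrow> continuous_on UNIV (curve h)"
  using curve_has_vector_derivative has_vector_derivative_continuous
  by (blast intro: continuous_at_imp_continuous_on)

lemma continuous_speed: "V centre < h \<Longrightarrow> continuous_on UNIV (speed h)"
  unfolding speed_def [abs_def]
  by (intro continuous_intros continuous_curve continuous_on_compose2 [OF continuous_grad continuous_curve])
    (use grad_outward in \<open>auto simp: curve_def less_imp_neq [symmetric]\<close>)

lemma speed_periodic: "V centre < h \<Longrightarrow> speed h (\<theta> + 2 * pi) = speed h \<theta>"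
  by (simp add: speed_def curve_periodic)

definition time :: "real \<Rightarrow> real \<Rightarrow> real" where
  "time h \<theta> = (LBINT x=0..\<theta>. speed h x)"

lemma time_deriv:
  assumes "V centre < h"
  shows "(time h has_real_derivative speed h \<theta>) (at \<theta>)"
proof -
  \<comment> \<open>The fundamental theorem gives a derivative within a compact interval; this one has both
    0 and \<open>\<theta>\<close> in its interior.\<close>
  define a b where "a = min 0 \<theta> - 1" and "b = max 0 \<theta> + 1"
  have ab: "a \<le> 0" "0 \<le> b" "a < \<theta>" "\<theta> < b" by (auto simp: a_def b_def)
  have "((\<lambda>u. LBINT x=0..u. speed h x) has_vector_derivative speed h \<theta>) (at \<theta> within {a..b})"
    using interval_integral_FTC2 [of a 0 b "speed h" \<theta>] ab
      continuous_on_subset [OF continuous_speed [OF assms]]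
    by (auto simp: zero_ereal_def)
  then have "((\<lambda>u. LBINT x=0..u. speed h x) has_vector_derivative speed h \<theta>) (at \<theta>)"
    using ab by (simp add: at_within_Icc_at)
  then show ?thesis
    unfolding time_def [abs_def] by (simp add: has_real_derivative_iff_has_vector_derivative zero_ereal_def)
qed

lemma time_mono: "V centre < h \<Longrightarrow> \<theta> < \<theta>' \<Longrightarrow> time h \<theta> < time h \<theta>'"
  by (rule DERIV_pos_imp_increasing) (use time_deriv speed_pos in blast)+

definition period :: "real \<Rightarrow> real" where
  "period h = time h (2 * pi) - time h 0"

lemma period_pos: "V centre < h \<Longrightarrow> 0 < period h"
  by (simp add: period_def time_mono)

lemma time_periodic:
  assumes "V centre < h"
  shows "time h (\<theta> + 2 * pi) = time h \<theta> + period h"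
proof -
  have "((\<lambda>t. time h (t + 2 * pi) - time h t) has_real_derivative 0) (at t)" for t
  proof -
    have "(time h has_real_derivative speed h t) (at (t + 2 * pi))"
      using time_deriv [OF assms, of "t + 2 * pi"] speed_periodic [OF assms, of t] by simp
    then have "((\<lambda>t. time h (t + 2 * pi)) has_real_derivative speed h t) (at t)"
      by (simp add: DERIV_shift)
    from DERIV_diff [OF this time_deriv [OF assms]] show ?thesis by simp
  qed
  then have "time h (\<theta> + 2 * pi) - time h \<theta> = time h (0 + 2 * pi) - time h 0"
    using DERIV_isconst_all [of "\<lambda>t. time h (t + 2 * pi) - time h t" \<theta> 0] by blast
  then show ?thesis by (simp add: period_def)
qed

lemma bij_time:
  assumes h: "V centre < h"
  shows "bij (time h)"
proof (rule bijI)
  show "inj (time h)"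
    using time_mono [OF h] by (intro linorder_injI) (metis less_irrefl)
  show "surj (time h)"
    unfolding surj_def
  proof
    fix t
    have up: "time h (real n * (2 * pi)) = time h 0 + real n * period h" for n
    proof (induction n)
      case (Suc n)
      then show ?case using time_periodic [OF h, of "real n * (2 * pi)"] by (simp add: algebra_simps)
    qed simp
    have down: "time h (- real n * (2 * pi)) = time h 0 - real n * period h" for n
    proof (induction n)
      case (Suc n)
      then show ?case using time_periodic [OF h, of "- real (Suc n) * (2 * pi)"] by (simp add: algebra_simps)
    qed simp
    obtain n :: nat where n: "real n * period h > \<bar>t\<bar> + \<bar>time h 0\<bar>"
      using ex_less_of_nat_mult [OF period_pos [OF h]] by blast
    have cont: "isCont (time h) x" for x using time_deriv [OF h] DERIV_isCont by blast
    have "\<exists>x\<ge>- real n * (2 * pi). x \<le> real n * (2 * pi) \<and> time h x = t"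
      using n by (intro IVT cont allI impI) (simp_all only: up down, auto)
    then show "\<exists>x. t = time h x" by blast
  qed
qed

text \<open>
  Reparametrizing a level curve by Hamiltonian time instead of angle gives an integral curve of
  the field \<open>\<i> * grad\<close>. It closes up because the time spent on a full turn does not depend on
  where the turn starts.
\<close>

lemma periodic_orbit:
  assumes "p \<noteq> centre"
  shows "\<exists>d T. 0 < T \<and> (\<forall>t. (d has_vector_derivative \<i> * grad (d t)) (at t)) \<and>
    (\<forall>t. d (t + T) = d t) \<and> range d = {q. V q = V p}"
proof -
  define h where "h = V p"
  have h: "V centre < h" unfolding h_def by (rule V_centre_less [OF assms])
  define A where "A = inv (time h)"
  have A: "time h (A t) = t" "A (time h \<theta>) = \<theta>" for t \<theta>
    using bij_time [OF h] by (auto simp: A_def bij_is_surj surj_f_inv_f bij_is_inj)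
  have "(A has_real_derivative inverse (speed h (A t))) (at t)" for t
  proof -
    have "continuous_on UNIV (time h)"
      using time_deriv [OF h] by (meson DERIV_continuous_on has_field_derivative_at_within)
    then have "(A has_derivative (\<lambda>s. inverse (speed h (A t)) * s)) (at (time h (A t)))"
      by (intro has_derivative_inverse_strong [of UNIV "A t" "time h" A "\<lambda>s. speed h (A t) * s"])
        (use A speed_pos [of h "A t"] time_deriv [OF h, of "A t"] in
          \<open>auto simp: fun_eq_iff has_field_derivative_def\<close>)
    then show ?thesis by (simp add: A has_field_derivative_def)
  qed
  then have dA: "(A has_vector_derivative inverse (speed h (A t))) (at t)" for t
    by (simp add: has_real_derivative_iff_has_vector_derivative)
  define d where "d = curve h \<circ> A"
  have "(d has_vector_derivative \<i> * grad (d t)) (at t)" for t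
    using vector_diff_chain_at [OF dA curve_has_vector_derivative [OF h], of t] speed_pos [of h "A t"]
    by (simp add: d_def)
  moreover have "d (t + period h) = d t" for t
  proof -
    have "A (t + period h) = A t + 2 * pi"
      using time_periodic [OF h, of "A t"] A by metis
    then show ?thesis using curve_periodic [OF h] by (simp add: d_def)
  qed
  moreover have "range d = {q. V q = V p}"
  proof (intro equalityI subsetI)
    fix q assume "q \<in> range d"
    then show "q \<in> {q. V q = V p}" using V_curve [OF h] by (auto simp: d_def h_def)
  next
    fix q assume "q \<in> {q. V q = V p}"
    then obtain \<theta> where "q = curve h \<theta>" using curve_surj [OF _ h] by (auto simp: h_def)
    then have "q = d (time h \<theta>)" using A by (simp add: d_def)
    then show "q \<in> range d" by blast
  qed
  ultimately show ?thesis using period_pos [OF h] by blast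
qed

section \<open>Uniqueness of Hamiltonian orbits\<close>

lemma grad_locally_lipschitz:
  "\<exists>L\<ge>0. \<forall>z w. norm z \<le> R \<longrightarrow> norm w \<le> R \<longrightarrow> norm (grad z - grad w) \<le> L * norm (z - w)"
proof -
  have le: "exp a - exp b \<le> exp M * \<bar>a - b\<bar>" if "a \<le> M" for a b M :: real
  proof -
    have "exp a - exp b = exp a * (1 - exp (b - a))" by (simp add: exp_diff field_simps)
    also have "\<dots> \<le> exp a * \<bar>a - b\<bar>"
    proof (rule mult_left_mono)
      show "1 - exp (b - a) \<le> \<bar>a - b\<bar>" using exp_ge_add_one_self [of "b - a"] by linarith
    qed simp
    also have "\<dots> \<le> exp M * \<bar>a - b\<bar>" using that by (intro mult_right_mono) auto
    finally show ?thesis .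
  qed
  define L where "L = (\<Sum>i\<in>I. c i * (exp (norm (k i) * R) * norm (k i)) * norm (k i))"
  have "norm (grad z - grad w) \<le> L * norm (z - w)" if R: "norm z \<le> R" "norm w \<le> R" for z w
  proof -
    have "norm (grad z - grad w) = norm (\<Sum>i\<in>I. (c i * (exp (k i \<bullet> z) - exp (k i \<bullet> w))) *\<^sub>R k i)"
      by (simp add: grad_def sum_subtractf [symmetric] algebra_simps)
    also have "\<dots> \<le> (\<Sum>i\<in>I. c i * (exp (norm (k i) * R) * norm (k i)) * norm (k i) * norm (z - w))"
    proof (rule sum_norm_le)
      fix i assume i: "i \<in> I"
      have "k i \<bullet> v \<le> norm (k i) * R" if "norm v \<le> R" for v
        using norm_cauchy_schwarz [of "k i" v] mult_left_mono [OF that, of "norm (k i)"] by simp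
      then have "\<bar>exp (k i \<bullet> z) - exp (k i \<bullet> w)\<bar> \<le> exp (norm (k i) * R) * \<bar>k i \<bullet> z - k i \<bullet> w\<bar>"
        using le [of "k i \<bullet> z" "norm (k i) * R" "k i \<bullet> w"]
          le [of "k i \<bullet> w" "norm (k i) * R" "k i \<bullet> z"] R
        by (simp add: abs_le_iff abs_minus_commute)
      also have "\<dots> \<le> exp (norm (k i) * R) * (norm (k i) * norm (z - w))"
        using Cauchy_Schwarz_ineq2 [of "k i" "z - w"] by (simp add: inner_diff_right)
      finally have "c i * \<bar>exp (k i \<bullet> z) - exp (k i \<bullet> w)\<bar> * norm (k i) \<le>
          c i * (exp (norm (k i) * R) * (norm (k i) * norm (z - w))) * norm (k i)"
        using nonneg [OF i] by (intro mult_right_mono mult_left_mono) auto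
      then show "norm ((c i * (exp (k i \<bullet> z) - exp (k i \<bullet> w))) *\<^sub>R k i) \<le>
          c i * (exp (norm (k i) * R) * norm (k i)) * norm (k i) * norm (z - w)"
        using nonneg [OF i] by (simp add: abs_mult mult_ac)
    qed
    also have "\<dots> = L * norm (z - w)" by (simp add: L_def sum_distrib_right)
    finally show ?thesis .
  qed
  moreover have "L \<ge> 0" unfolding L_def by (intro sum_nonneg mult_nonneg_nonneg) (auto simp: nonneg)
  ultimately show ?thesis by blast
qed

definition integral_curve :: "(real \<Rightarrow> complex) \<Rightarrow> bool" where
  "integral_curve d \<longleftrightarrow> (\<forall>t. (d has_vector_derivative \<i> * grad (d t)) (at t))"

lemma integral_curve_shift: "integral_curve d \<Longrightarrow> integral_curve (\<lambda>t. d (t + s))"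
proof -
  assume d: "integral_curve d"
  have "((\<lambda>t. d (t + s)) has_vector_derivative \<i> * grad (d (t + s))) (at t)" for t
  proof -
    have "((\<lambda>t. t + s) has_vector_derivative 1) (at t)"
      by (auto intro!: derivative_eq_intros)
    from vector_diff_chain_at [OF this, of d "\<i> * grad (d (t + s))"] d show ?thesis
      by (simp add: integral_curve_def o_def)
  qed
  then show ?thesis by (simp add: integral_curve_def)
qed

text \<open>
  Gronwall's argument: the squared distance \<open>g\<close> of the two curves satisfies \<open>|g'| \<le> 2 L g\<close>
  with a Lipschitz constant \<open>L\<close> valid on the bounded sublevel set, so \<open>g\<close> times a suitable
  exponential is monotone and starts at zero.
\<close>

lemma integral_curve_unique:
  assumes "integral_curve d" "integral_curve e"
    and "\<And>t. V (d t) \<le> h" "\<And>t. V (e t) \<le> h" and "d 0 = e 0"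
  shows "d = e"
proof
  fix t
  obtain R where R: "\<And>z. V z \<le> h \<Longrightarrow> norm z \<le> R"
    using bounded_sublevel [of h] by (auto simp: bounded_iff)
  obtain L where L: "L \<ge> 0"
      "\<And>z w. norm z \<le> R \<Longrightarrow> norm w \<le> R \<Longrightarrow> norm (grad z - grad w) \<le> L * norm (z - w)"
    using grad_locally_lipschitz [of R] by blast
  define g where "g = (\<lambda>t. (d t - e t) \<bullet> (d t - e t))"
  define g' where "g' = (\<lambda>t. 2 * ((\<i> * (grad (d t) - grad (e t))) \<bullet> (d t - e t)))"
  have g: "(g has_real_derivative g' t) (at t)" for t
  proof -
    have "((\<lambda>t. d t - e t) has_vector_derivative \<i> * (grad (d t) - grad (e t))) (at t)"
      using assms(1,2) has_vector_derivative_diff [of d _ "at t" e]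
      by (auto simp: integral_curve_def algebra_simps)
    then have "((\<lambda>t. d t - e t) has_derivative (\<lambda>s. s *\<^sub>R (\<i> * (grad (d t) - grad (e t))))) (at t)"
      by (simp add: has_vector_derivative_def)
    from has_derivative_inner [OF this this] show ?thesis
      unfolding g_def g'_def has_field_derivative_def
      by (rule has_derivative_eq_rhs) (simp add: fun_eq_iff inner_commute)
  qed
  have g': "\<bar>g' t\<bar> \<le> 2 * L * g t" for t
  proof -
    have "\<bar>g' t\<bar> \<le> 2 * (norm (\<i> * (grad (d t) - grad (e t))) * norm (d t - e t))"
      unfolding g'_def using Cauchy_Schwarz_ineq2 by (simp add: abs_mult)
    also have "\<dots> \<le> 2 * ((L * norm (d t - e t)) * norm (d t - e t))"
      using L(2) [OF R R] assms(3,4) by (intro mult_left_mono mult_right_mono) (auto simp: norm_mult)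
    also have "\<dots> = 2 * L * g t"
      by (simp add: g_def dot_square_norm power2_eq_square)
    finally show ?thesis .
  qed
  have g0: "g 0 = 0" using assms(5) by (simp add: g_def)
  have "g t \<le> 0"
  proof (cases "t \<ge> 0")
    case True
    have "g t * exp (- 2 * L * t) \<le> g 0 * exp (- 2 * L * 0)"
    proof (rule DERIV_nonpos_imp_nonincreasing [OF True])
      fix x
      have "((\<lambda>x. g x * exp (- 2 * L * x)) has_real_derivative (g' x - 2 * L * g x) * exp (- 2 * L * x)) (at x)"
        by (rule derivative_eq_intros g refl | simp add: algebra_simps)+
      moreover have "(g' x - 2 * L * g x) * exp (- 2 * L * x) \<le> 0"
        using g' [of x] by (intro mult_nonpos_nonneg) auto
      ultimately show "\<exists>y. ((\<lambda>x. g x * exp (- 2 * L * x)) has_real_derivative y) (at x) \<and> y \<le> 0"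
        by blast
    qed
    then show ?thesis by (simp add: g0 mult_le_0_iff)
  next
    case False
    then have t: "t \<le> 0" by simp
    have "g t * exp (2 * L * t) \<le> g 0 * exp (2 * L * 0)"
    proof (rule DERIV_nonneg_imp_nondecreasing [OF t])
      fix x
      have "((\<lambda>x. g x * exp (2 * L * x)) has_real_derivative (g' x + 2 * L * g x) * exp (2 * L * x)) (at x)"
        by (rule derivative_eq_intros g refl | simp add: algebra_simps)+
      moreover have "0 \<le> (g' x + 2 * L * g x) * exp (2 * L * x)"
        using g' [of x] by (intro mult_nonneg_nonneg) auto
      ultimately show "\<exists>y. ((\<lambda>x. g x * exp (2 * L * x)) has_real_derivative y) (at x) \<and> 0 \<le> y"
        by blast
    qed
    then show ?thesis by (simp add: g0 mult_le_0_iff)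
  qed
  then show "d t = e t" by (simp add: g_def dot_square_norm)
qed

end

section \<open>Area-preserving maps with an invariant potential\<close>

text \<open>
  The expression \<open>(\<i> * u) \<bullet> v\<close> is the determinant of the pair \<open>u, v\<close>, so the condition says
  that the derivative has determinant \<open>1\<close>.
\<close>

definition area_preserving :: "(complex \<Rightarrow> complex) \<Rightarrow> bool" where
  "area_preserving F \<longleftrightarrow>
    (\<forall>z. \<exists>D. (F has_derivative D) (at z) \<and> (\<forall>u v. (\<i> * D u) \<bullet> D v = (\<i> * u) \<bullet> v))"

lemma area_preserving_id: "area_preserving (\<lambda>z. z)"
  unfolding area_preserving_def by (intro allI exI [of _ "\<lambda>u. u"]) auto

lemma area_preserving_compose:
  assumes "area_preserving F" "area_preserving H"
  shows "area_preserving (\<lambda>z. H (F z))"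
  unfolding area_preserving_def
proof
  fix z
  obtain D where D: "(F has_derivative D) (at z)" "\<And>u v. (\<i> * D u) \<bullet> D v = (\<i> * u) \<bullet> v"
    using assms(1) unfolding area_preserving_def by blast
  obtain E where E: "(H has_derivative E) (at (F z))" "\<And>u v. (\<i> * E u) \<bullet> E v = (\<i> * u) \<bullet> v"
    using assms(2) unfolding area_preserving_def by blast
  show "\<exists>D. ((\<lambda>z. H (F z)) has_derivative D) (at z) \<and> (\<forall>u v. (\<i> * D u) \<bullet> D v = (\<i> * u) \<bullet> v)"
    using has_derivative_compose [OF D(1) E(1)] D(2) E(2) by (intro exI conjI) auto
qed

lemma area_form_nondegenerate:
  assumes "\<And>v. (\<i> * u) \<bullet> v = 0"
  shows "u = 0"
  using assms [of "\<i> * u"] by (simp add: inner_eq_zero_iff)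

context positive_exp_sum
begin

text \<open>
  The Hamiltonian field is characterized by the area form and the differential of \<open>V\<close>, and
  \<open>F\<close> preserves both.
\<close>

lemma hamiltonian_field_invariant:
  assumes D: "(F has_derivative D) (at z)" "\<And>u v. (\<i> * D u) \<bullet> D v = (\<i> * u) \<bullet> v"
    and inv: "\<And>z. V (F z) = V z"
  shows "D (\<i> * grad z) = \<i> * grad (F z)"
proof -
  have lin: "linear D" using D(1) has_derivative_linear by blast
  have "inj D"
    using area_form_nondegenerate D(2)
    by (intro iffD2 [OF linear_injective_0 [OF lin]]) (metis inner_zero_right mult_zero_right inner_zero_left)
  then have surj: "surj D" using linear_injective_imp_surjective lin by blast
  have "((\<lambda>z. V (F z)) has_derivative (\<lambda>u. grad (F z) \<bullet> D u)) (at z)"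
    by (rule has_derivative_compose [OF D(1) V_has_derivative])
  then have grad: "grad (F z) \<bullet> D u = grad z \<bullet> u" for u
    using has_derivative_unique [OF _ V_has_derivative [of z]] inv by (metis (no_types, lifting) ext)
  \<comment> \<open>Both vectors have the same area with every \<open>D u\<close>, and these exhaust the plane.\<close>
  have "(\<i> * (D (\<i> * grad z) - \<i> * grad (F z))) \<bullet> D u = 0" for u
    using D(2) [of "\<i> * grad z" u] grad [of u] by (simp add: algebra_simps inner_diff_left)
  then have "(\<i> * (D (\<i> * grad z) - \<i> * grad (F z))) \<bullet> v = 0" for v
    using surj by (metis surjD)
  from area_form_nondegenerate [OF this] show ?thesis by simp
qed

text \<open>
  \<open>F\<close> maps an integral curve on a level set to an integral curve on the same level set. The level
  set is a single orbit, so the image is a time shift of the original curve.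
\<close>

theorem invariant_level_rotation:
  assumes F: "area_preserving F" and inv: "\<And>z. V (F z) = V z" and "p \<noteq> centre"
  shows "\<exists>d T \<tau>. 0 < T \<and> (\<forall>t. \<exists>v. v \<noteq> 0 \<and> (d has_vector_derivative v) (at t)) \<and>
    (\<forall>t. d (t + T) = d t) \<and> d 0 = p \<and> (\<forall>t. F (d t) = d (t + \<tau>))"
proof -
  obtain e T where e: "0 < T" "integral_curve e" "\<And>t. e (t + T) = e t"
      "range e = {q. V q = V p}"
    using periodic_orbit [OF \<open>p \<noteq> centre\<close>] unfolding integral_curve_def by blast
  have "p \<in> range e" unfolding e(4) by simp
  then obtain s where s: "p = e s" by blast
  define d where "d = (\<lambda>t. e (t + s))"
  have d: "integral_curve d" "d 0 = p" "d (t + T) = d t" for t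
    using integral_curve_shift [OF e(2), of s] e(3) [of "t + s"] s
    by (simp_all add: d_def add.assoc add.commute [of T])
  have Ve: "V (e t) = V p" for t using e(4) by blast
  then have Vd: "V (d t) = V p" for t by (simp add: d_def)
  have "F p \<in> range e" unfolding e(4) by (simp add: inv)
  then obtain r where r: "F p = e r" by blast
  define \<tau> where "\<tau> = r - s"
  have \<tau>: "F (d 0) = d \<tau>" using r d(2) by (simp add: d_def \<tau>_def)
  have "integral_curve (\<lambda>t. F (d t))"
    unfolding integral_curve_def
  proof
    fix t
    obtain D where D: "(F has_derivative D) (at (d t))" "\<And>u v. (\<i> * D u) \<bullet> D v = (\<i> * u) \<bullet> v"
      using F unfolding area_preserving_def by blast
    have "(d has_derivative (\<lambda>x. x *\<^sub>R (\<i> * grad (d t)))) (at t)"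
      using d(1) by (simp add: integral_curve_def has_vector_derivative_def)
    from has_derivative_compose [OF this D(1)]
    show "((\<lambda>t. F (d t)) has_vector_derivative \<i> * grad (F (d t))) (at t)"
      using hamiltonian_field_invariant [OF D inv] linear_cmul [OF has_derivative_linear [OF D(1)]]
      by (simp add: has_vector_derivative_def)
  qed
  then have "(\<lambda>t. F (d t)) = (\<lambda>t. d (t + \<tau>))"
    by (rule integral_curve_unique [OF _ integral_curve_shift [OF d(1)], of _ "V p"])
      (auto simp: inv Vd \<tau>)
  moreover have "\<exists>v. v \<noteq> 0 \<and> (d has_vector_derivative v) (at t)" for t
  proof -
    have "d t \<noteq> centre" using Vd [of t] V_centre_less [OF \<open>p \<noteq> centre\<close>] by auto
    then have "grad (d t) \<noteq> 0" using grad_outward [of "d t - centre"] by auto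
    then show ?thesis using d(1) by (auto simp: integral_curve_def intro!: exI [of _ "\<i> * grad (d t)"])
  qed
  ultimately show ?thesis using e(1) d by (intro exI [of _ d] exI [of _ T] exI [of _ \<tau>]) (auto dest: fun_cong)
qed

lemma invariant_fixes_minimum:
  assumes "\<And>z. V (F z) = V z"
  shows "F centre = centre"
  using V_centre_less [of "F centre"] assms [of centre] by force

end

section \<open>Lyness recurrences with a cyclic list of parameters\<close>

definition steps :: "real list \<Rightarrow> real \<times> real \<Rightarrow> real \<times> real" where
  "steps as = fold lyness_map as"

text \<open>
  The shift by one reflects that the sequences start at index \<open>1\<close>.
\<close>

definition cyc :: "'a list \<Rightarrow> nat \<Rightarrow> 'a" where
  "cyc as n = as ! ((n - 1) mod length as)"

lemma steps_simps [simp]: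
  "steps [] = id" "steps (a # as) z = steps as (lyness_map a z)"
  "steps (as @ bs) z = steps bs (steps as z)"
  by (simp_all add: steps_def)

lemma lyness_map_simp [simp]: "lyness_map a (x, y) = (y, (a + y) / x)"
  by (simp add: lyness_map_def)

lemma cyc_period: "1 \<le> n \<Longrightarrow> cyc as (n + length as * j) = cyc as n"
  by (simp add: cyc_def) (metis Nat.diff_add_assoc2 mod_mult_self2)

lemma cyc_nth: "i < length as \<Longrightarrow> cyc as (Suc i) = as ! i"
  by (simp add: cyc_def)

lemma cyc_image: "cyc as ` {1..length as} = set as"
proof -
  have "cyc as ` {1..length as} = (\<lambda>i. cyc as (Suc i)) ` {0..<length as}"
    by (simp flip: image_image image_Suc_atLeastLessThan atLeastLessThanSuc_atLeastAtMost)
  also have "\<dots> = (\<lambda>i. as ! i) ` {0..<length as}" by (rule image_cong) (auto simp: cyc_nth)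
  finally show ?thesis by (auto simp: set_conv_nth)
qed

lemma lyness_comp_cyc: "i \<le> length as \<Longrightarrow> lyness_comp (cyc as) i = steps (take i as)"
proof (induction i)
  case (Suc i)
  then show ?case by (auto simp: cyc_nth take_Suc_conv_app_nth fun_eq_iff)
qed simp

text \<open>
  A value that occurs exactly once per period can only recur after a multiple of that period.
\<close>

lemma cyc_period_dvd:
  assumes "i < length as" "\<And>j. j < length as \<Longrightarrow> as ! j = as ! i \<Longrightarrow> j = i"
    and q: "has_period (cyc as) q"
  shows "length as dvd q"
proof -
  have ne: "length as \<ge> 1" using assms(1) by simp
  have "cyc as (Suc i + q) = cyc as (Suc i)" and "q \<ge> 1"
    using q unfolding has_period_def by auto
  then have "as ! ((i + q) mod length as) = as ! i"
    using assms(1) by (simp add: cyc_def)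
  then have "(i + q) mod length as = i" using assms ne by (meson mod_less_divisor less_le_trans zero_less_one)
  then show ?thesis by (metis add_diff_cancel_left' dvd_minus_mod)
qed

lemma primitive_cyc:
  assumes "i < length as" "\<And>j. j < length as \<Longrightarrow> as ! j = as ! i \<Longrightarrow> j = i"
  shows "primitive_period (cyc as) (length as)"
proof -
  have "has_period (cyc as) (length as)"
    unfolding has_period_def using assms(1) cyc_period [of _ as 1] by auto
  moreover have "length as \<le> q" if "has_period (cyc as) q" for q
    using cyc_period_dvd [OF assms that] that by (auto simp: has_period_def dvd_imp_le)
  ultimately show ?thesis by (auto simp: primitive_period_def)
qed

lemma steps_pos:
  assumes "\<forall>a\<in>set as. 0 < a" "0 < x" "0 < y"
  shows "\<exists>x' y'. steps as (x, y) = (x', y') \<and> 0 < x' \<and> 0 < y'"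
  using assms by (induction as arbitrary: x y) (auto simp: field_simps)

lemma solution_pos:
  assumes "pos_seq a" "lyness_solution a x" "n \<ge> 1"
  shows "0 < x n \<and> 0 < x (Suc n)"
  using \<open>n \<ge> 1\<close>
proof (induction n rule: nat_induct_at_least)
  case base then show ?case using assms by (simp add: lyness_solution_def numeral_2_eq_2)
next
  case (Suc n)
  then have "x (Suc (Suc n)) = (a n + x (Suc n)) / x n" "0 < a n"
    using assms by (auto simp: lyness_solution_def pos_seq_def)
  with Suc show ?case by simp
qed

lemma pos_seq_cyc: "\<lbrakk>as \<noteq> []; \<forall>a\<in>set as. 0 < a\<rbrakk> \<Longrightarrow> pos_seq (cyc as)"
  by (simp add: pos_seq_def cyc_def)

lemma solution_steps:
  assumes "lyness_solution (cyc as) x" "i \<le> length as"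
  shows "(x (Suc (n * length as + i)), x (Suc (Suc (n * length as + i)))) =
    steps (take i as) ((steps as ^^ n) (x 1, x 2))"
proof -
  have step: "(x (Suc (Suc j)), x (Suc (Suc (Suc j)))) =
      lyness_map (cyc as (Suc j)) (x (Suc j), x (Suc (Suc j)))" for j
    using assms(1) by (auto simp: lyness_solution_def dest: spec [of _ "Suc j"])
  have seg: "(x (Suc (b * length as + i)), x (Suc (Suc (b * length as + i)))) =
      steps (take i as) (x (Suc (b * length as)), x (Suc (Suc (b * length as))))"
    if "i \<le> length as" for b i
    using that
  proof (induction i)
    case (Suc i)
    have "cyc as (Suc (b * length as + i)) = as ! i"
      using Suc.prems by (simp add: cyc_def)
    with Suc step [of "b * length as + i"] show ?case
      by (simp add: take_Suc_conv_app_nth)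
  qed simp
  have "(x (Suc (n * length as)), x (Suc (Suc (n * length as)))) = (steps as ^^ n) (x 1, x 2)"
  proof (induction n)
    case 0 then show ?case by (simp add: numeral_2_eq_2)
  next
    case (Suc n)
    then show ?case using seg [of "length as" n] by (simp add: add.commute)
  qed
  then show ?thesis using seg [OF assms(2), of n] by simp
qed

section \<open>Laurent invariants, integrability and persistence\<close>

fun laurent :: "real \<Rightarrow> real \<Rightarrow> real \<Rightarrow> real \<Rightarrow> real \<Rightarrow> real \<Rightarrow> real \<Rightarrow> real \<times> real \<Rightarrow> real" where
  "laurent A B C D E G H (x, y) =
    A * x + B * y + C * x / y + D * y / x + E / y + G / x + H / (x * y)"

definition laurent_invariant :: "real list \<Rightarrow> bool" where
  "laurent_invariant as \<longleftrightarrow> (\<exists>A B C D E G H.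
    0 < A \<and> 0 < B \<and> 0 \<le> C \<and> 0 \<le> D \<and> 0 < E \<and> 0 < G \<and> 0 \<le> H \<and>
    (\<forall>x>0. \<forall>y>0. laurent A B C D E G H (steps as (x, y)) = laurent A B C D E G H (x, y)))"

lemma laurent_invariantE:
  assumes "laurent_invariant as"
  obtains A B C D E G H where
    "0 < A" "0 < B" "0 \<le> C" "0 \<le> D" "0 < E" "0 < G" "0 \<le> H"
    "\<And>x y. 0 < x \<Longrightarrow> 0 < y \<Longrightarrow>
      laurent A B C D E G H (steps as (x, y)) = laurent A B C D E G H (x, y)"
  using assms unfolding laurent_invariant_def
proof (elim exE conjE)
  fix A B C D E G H
  assume "0 < A" "0 < B" "0 \<le> C" "0 \<le> D" "0 < E" "0 < G" "0 \<le> H"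
    and "\<forall>x>0. \<forall>y>0. laurent A B C D E G H (steps as (x, y)) = laurent A B C D E G H (x, y)"
  then show thesis by (intro that [of A B C D E G H]) simp_all
qed

lemma prime_elem_X: "prime_elem ([:0, 1:] :: 'a :: idom poly)"
  by (intro prime_elemI)
    (auto simp: poly_eq_0_iff_dvd [of _ 0, simplified, symmetric])

lemma coprime_mult_primes:
  fixes P :: "'a :: algebraic_semidom"
  assumes "prime_elem p" "prime_elem q" "\<not> p dvd P" "\<not> q dvd P"
  shows "coprime P (p * q)"
proof (rule coprimeI)
  fix d assume dP: "d dvd P" and "d dvd p * q"
  then obtain e where e: "p * q = d * e" by (elim dvdE)
  have "\<not> p dvd d" "\<not> q dvd d" using assms(3,4) dP dvd_trans by blast+
  then have "p dvd e" using prime_elem_dvd_multD [OF assms(1), of d e] by (metis dvd_triv_left e)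
  then obtain e' where "e = p * e'" by (elim dvdE)
  then have "p * q = p * (d * e')" using e by (simp add: mult_ac)
  moreover have "p \<noteq> 0" "q \<noteq> 0" using assms(1,2) by auto
  ultimately have q: "q = d * e'" by simp
  then have "q dvd e'" using \<open>\<not> q dvd d\<close> prime_elem_dvd_multD [OF assms(2), of d e'] by auto
  then obtain e'' where "e' = q * e''" by (elim dvdE)
  then have "q * 1 = q * (d * e'')" using q by (metis mult.left_commute mult.right_neutral)
  then have "1 = d * e''" using \<open>q \<noteq> 0\<close> mult_left_cancel by blast
  then show "is_unit d" by (rule dvdI)
qed

text \<open>
  Multiplying the invariant by \<open>xy\<close> gives a polynomial \<open>P\<close>, and \<open>P / (xy)\<close> is in lowest terms:
  \<open>x\<close> does not divide \<open>P\<close> because of its monomial \<open>G y\<close>, and \<open>y\<close> does not because of \<open>E x\<close>.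
\<close>

lemma rationally_integrable_steps:
  assumes pos: "\<forall>a\<in>set as. 0 < a" and inv: "laurent_invariant as"
  shows "rationally_integrable (steps as)"
proof -
  obtain A B C D E G H where coef: "0 < A" "0 < B" "0 \<le> C" "0 \<le> D" "0 < E" "0 < G" "0 \<le> H"
    and L: "\<And>x y. 0 < x \<Longrightarrow> 0 < y \<Longrightarrow>
      laurent A B C D E G H (steps as (x, y)) = laurent A B C D E G H (x, y)"
    using laurent_invariantE [OF inv] by metis
  define P :: "real poly poly" where
    "P = [: [:H, E, C:], [:G, 0, A:], [:D, B:] :]"
  define Q :: "real poly poly" where "Q = [:0, 1:] * [:[:0, 1:]:]"
  have evalQ: "eval2 Q (x, y) = x * y" for x y by (simp add: eval2_def Q_def)
  have evalP: "eval2 P (x, y) = laurent A B C D E G H (x, y) * (x * y)" if "0 < x" "0 < y" for x y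
    using that by (simp add: eval2_def P_def field_simps)
  have "eval2 P (steps as z) * eval2 Q z = eval2 P z * eval2 Q (steps as z)"
    if z: "z \<in> Qplus" for z
  proof -
    obtain x y where xy: "z = (x, y)" "0 < x" "0 < y" using z by (auto simp: Qplus_def)
    obtain x' y' where xy': "steps as (x, y) = (x', y')" "0 < x'" "0 < y'"
      using steps_pos [OF pos xy(2,3)] by blast
    show ?thesis
      using L [OF xy(2,3)] xy xy' by (simp add: evalP evalQ del: laurent.simps)
  qed
  moreover have "P \<noteq> smult [:c:] Q" for c
  proof
    assume "P = smult [:c:] Q"
    then have "coeff (coeff P 1) 2 = coeff (coeff (smult [:c:] Q) 1) 2" by simp
    with coef(1) show False by (simp add: P_def Q_def numeral_2_eq_2)
  qed
  moreover have "coprime P Q"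
    unfolding Q_def
  proof (rule coprime_mult_primes)
    show "\<not> [:0, 1:] dvd P"
      using coef(5) by (simp add: P_def poly_eq_0_iff_dvd [of _ 0, simplified, symmetric])
    have "\<not> [:0, 1:] dvd coeff P 1"
      using coef(6) by (simp add: P_def poly_eq_0_iff_dvd [of _ 0, simplified, symmetric])
    then show "\<not> [:[:0, 1:]:] dvd P" by (auto simp: const_poly_dvd_iff)
  qed (simp_all add: prime_elem_X lift_prime_elem_poly)
  moreover have "Q \<noteq> 0" by (simp add: Q_def)
  ultimately show ?thesis unfolding rationally_integrable_def by blast
qed

text \<open>
  Once per period the invariant bounds two consecutive terms from above and below, since each
  of \<open>A x\<close>, \<open>B y\<close>, \<open>E / y\<close>, \<open>G / x\<close> is at most its value. The bounds propagate through the
  finitely many remaining steps of the period.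
\<close>

lemma solution_bounds:
  assumes pos: "\<forall>a\<in>set as. 0 < a" and inv: "laurent_invariant as" and "as \<noteq> []"
    and sol: "lyness_solution (cyc as) x"
  shows "\<exists>l u. 0 < l \<and> (\<forall>n\<ge>1. l < x n \<and> x n < u)"
proof -
  obtain A B C D E G H where coef: "0 < A" "0 < B" "0 \<le> C" "0 \<le> D" "0 < E" "0 < G" "0 \<le> H"
    and L: "\<And>x y. 0 < x \<Longrightarrow> 0 < y \<Longrightarrow>
      laurent A B C D E G H (steps as (x, y)) = laurent A B C D E G H (x, y)"
    using laurent_invariantE [OF inv] by metis
  let ?k = "length as"
  have a: "0 < cyc as n" for n using pos \<open>as \<noteq> []\<close> by (simp add: cyc_def)
  have xpos: "0 < x (Suc n)" for n
    using solution_pos [OF pos_seq_cyc [OF \<open>as \<noteq> []\<close> pos] sol, of "Suc n"] by simp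
  define h where "h = laurent A B C D E G H (x 1, x 2)"
  have level: "laurent A B C D E G H (x (Suc (n * ?k)), x (Suc (Suc (n * ?k)))) = h" for n
  proof (induction n)
    case 0 then show ?case by (simp add: h_def numeral_2_eq_2)
  next
    case (Suc n)
    have "(x (Suc (Suc n * ?k)), x (Suc (Suc (Suc n * ?k)))) =
        steps as (x (Suc (n * ?k)), x (Suc (Suc (n * ?k))))"
      using solution_steps [OF sol, of 0 n] solution_steps [OF sol, of 0 "Suc n"] by simp
    then show ?case using L [OF xpos xpos] Suc by simp
  qed
  have "\<exists>l u. 0 < l \<and> (\<forall>n. l < x (Suc (n * ?k + i)) \<and> x (Suc (n * ?k + i)) < u \<and>
      l < x (Suc (Suc (n * ?k + i))) \<and> x (Suc (Suc (n * ?k + i))) < u)" for i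
  proof (induction i)
    case 0
    have "A * s < h \<and> G / s < h \<and> B * t < h \<and> E / t < h"
      if "laurent A B C D E G H (s, t) = h" "0 < s" "0 < t" for s t
    proof -
      have "0 < A * s" "0 < B * t" "0 < E / t" "0 < G / s" "0 \<le> C * s / t" "0 \<le> D * t / s"
        "0 \<le> H / (s * t)" using coef that by auto
      then show ?thesis using that(1) by simp
    qed
    then have "A * x (Suc (n * ?k)) < h \<and> G / x (Suc (n * ?k)) < h \<and>
        B * x (Suc (Suc (n * ?k))) < h \<and> E / x (Suc (Suc (n * ?k))) < h" for n
      using level xpos by blast
    moreover from this have "0 < h" using coef(1) xpos [of 0] by (meson mult_pos_pos less_trans calculation xpos)
    ultimately have *: "x (Suc (n * ?k)) < h / A" "G / h < x (Suc (n * ?k))"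
        "x (Suc (Suc (n * ?k))) < h / B" "E / h < x (Suc (Suc (n * ?k)))" for n
      using coef xpos by (auto simp: field_simps)
    show ?case
      using * \<open>0 < h\<close> coef
      by (intro exI [of _ "min (G / h) (E / h)"] exI [of _ "max (h / A) (h / B)"])
        (auto simp: min_less_iff_disj less_max_iff_disj)
  next
    case (Suc i)
    then obtain l u where l: "0 < l" and lu: "\<And>n. l < x (Suc (n * ?k + i))"
        "\<And>n. x (Suc (n * ?k + i)) < u" "\<And>n. l < x (Suc (Suc (n * ?k + i)))"
        "\<And>n. x (Suc (Suc (n * ?k + i))) < u" by blast
    have u: "0 < u" using l lu(1,2) [of 0] by linarith
    define c where "c = cyc as (Suc i)"
    have c: "0 < c" by (simp add: c_def a)
    have "cyc as (Suc (n * ?k + i)) = c" for n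
      using cyc_period [of "Suc i" as n] by (simp add: c_def algebra_simps)
    then have next_eq: "x (Suc (Suc (Suc (n * ?k + i)))) =
        (c + x (Suc (Suc (n * ?k + i)))) / x (Suc (n * ?k + i))" for n
      using sol by (auto simp: lyness_solution_def dest: spec [of _ "Suc (n * ?k + i)"])
    have up: "x (Suc (Suc (Suc (n * ?k + i)))) < (c + u) / l" for n
      unfolding next_eq using lu [of n] l c by (intro frac_less) auto
    have down: "(c + l) / u < x (Suc (Suc (Suc (n * ?k + i))))" for n
      unfolding next_eq using lu [of n] l c by (intro frac_less2) auto
    show ?case
      using l lu u c up down
      by (intro exI [of _ "min l ((c + l) / u)"] exI [of _ "max u ((c + u) / l)"])
        (auto simp: min_less_iff_disj less_max_iff_disj)
  qed
  then have "\<exists>l u. \<forall>i. 0 < l i \<and> (\<forall>n. l i < x (Suc (n * ?k + i)) \<and> x (Suc (n * ?k + i)) < u i)"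
    by meson
  then obtain l u where lu: "\<And>i. 0 < l i" "\<And>i n. l i < x (Suc (n * ?k + i))"
      "\<And>i n. x (Suc (n * ?k + i)) < u i" by blast
  define l0 u0 where "l0 = Min (l ` {..<?k})" and "u0 = Max (u ` {..<?k})"
  have ne: "{..<?k} \<noteq> {}" using \<open>as \<noteq> []\<close> by auto
  have "0 < l0" unfolding l0_def using ne lu(1) by (subst Min_gr_iff) auto
  moreover have "l0 < x n \<and> x n < u0" if "n \<ge> 1" for n
  proof -
    define i where "i = (n - 1) mod ?k"
    have "n = Suc ((n - 1) div ?k * ?k + i)" using that by (simp add: i_def)
    moreover have "i < ?k" using \<open>as \<noteq> []\<close> by (simp add: i_def)
    then have "l0 \<le> l i" "u i \<le> u0" unfolding l0_def u0_def by auto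
    ultimately show ?thesis using lu(2,3) [where i = i and n = "(n - 1) div ?k"] by (metis order_le_less_trans order_less_le_trans)
  qed
  ultimately show ?thesis by blast
qed

lemma persistent_cyc:
  assumes "\<forall>a\<in>set as. 0 < a" "laurent_invariant as" "as \<noteq> []"
  shows "persistent (cyc as)"
  unfolding persistent_def
proof (intro allI impI)
  fix x assume sol: "lyness_solution (cyc as) x"
  obtain l u where "0 < l" "\<And>n. n \<ge> 1 \<Longrightarrow> l < x n \<and> x n < u"
    using solution_bounds [OF assms sol] by blast
  then show "\<exists>c C. c > 0 \<and> C > 0 \<and> (\<forall>n\<ge>1. c < x n \<and> x n < C)"
    by (metis less_trans order_refl)
qed

section \<open>The dichotomy in logarithmic coordinates\<close>

text \<open>
  The Lyness map in the coordinates \<open>log x, log y\<close>. Its derivative is the matrix with rows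
  \<open>(0, 1)\<close> and \<open>(- 1, s)\<close>, whose determinant is \<open>1\<close>.
\<close>

definition log_lyness_map :: "real \<Rightarrow> complex \<Rightarrow> complex" where
  "log_lyness_map a z = Complex (Im z) (ln (a + exp (Im z)) - Re z)"

definition log_steps :: "real list \<Rightarrow> complex \<Rightarrow> complex" where
  "log_steps as = fold log_lyness_map as"

definition exp2 :: "complex \<Rightarrow> real \<times> real" where
  "exp2 z = (exp (Re z), exp (Im z))"

lemma log_steps_simps [simp]: "log_steps [] z = z" "log_steps (a # as) z = log_steps as (log_lyness_map a z)"
  by (simp_all add: log_steps_def)

lemma steps_exp2: "\<forall>a\<in>set as. 0 < a \<Longrightarrow> steps as (exp2 z) = exp2 (log_steps as z)"
proof (induction as arbitrary: z)
  case (Cons a as)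
  have "0 < a + exp (Im z)" using Cons.prems by (simp add: add_pos_pos)
  then have "lyness_map a (exp2 z) = exp2 (log_lyness_map a z)"
    by (simp add: exp2_def log_lyness_map_def exp_diff)
  with Cons show ?case by simp
qed simp

lemma area_preserving_log_lyness_map:
  assumes "0 < a"
  shows "area_preserving (log_lyness_map a)"
  unfolding area_preserving_def
proof
  fix z
  define s where "s = exp (Im z) / (a + exp (Im z))"
  have pos: "0 < a + exp (Im z)" using assms by (simp add: add_pos_pos)
  have "((\<lambda>z. ln (a + exp (Im z)) - Re z) has_derivative (\<lambda>v. s * Im v - Re v)) (at z)"
    using pos by (auto intro!: derivative_eq_intros simp: s_def divide_inverse mult_ac)
  then have "(log_lyness_map a has_derivative (\<lambda>v. Complex (Im v) (s * Im v - Re v))) (at z)"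
    using has_derivative_add [OF has_derivative_of_real [OF has_derivative_Im [OF has_derivative_ident]]
        has_derivative_mult_right [OF has_derivative_of_real, of _ _ _ \<i>]]
    unfolding log_lyness_map_def [abs_def] Complex_eq by blast
  then show "\<exists>D. (log_lyness_map a has_derivative D) (at z) \<and> (\<forall>u v. (\<i> * D u) \<bullet> D v = (\<i> * u) \<bullet> v)"
    by (intro exI conjI) (auto simp: inner_complex_def algebra_simps)
qed

lemma area_preserving_log_steps:
  assumes "\<forall>a\<in>set as. 0 < a"
  shows "area_preserving (log_steps as)"
  using assms
proof (induction as)
  case Nil then show ?case using area_preserving_id by (simp add: log_steps_def id_def)
next
  case (Cons a as)
  then show ?case
    using area_preserving_compose [OF area_preserving_log_lyness_map [of a], of "log_steps as"]
    by (simp add: log_steps_def comp_def)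
qed

text \<open>
  The exponent vectors of the monomials of \<open>laurent\<close>, in the order of its coefficients.
\<close>

abbreviation exponents :: "nat \<Rightarrow> complex" where
  "exponents \<equiv> (!) [1, \<i>, 1 - \<i>, \<i> - 1, - \<i>, - 1, - 1 - \<i>]"

lemma laurent_positive_exp_sum:
  assumes "0 < A" "0 < B" "0 \<le> C" "0 \<le> D" "0 < E" "0 < G" "0 \<le> H"
  shows "positive_exp_sum {..<7::nat} exponents ((!) [A, B, C, D, E, G, H])"
    (is "positive_exp_sum _ _ ?c")
proof
  show "0 \<le> ?c i" if "i \<in> {..<7}" for i
    using that assms by (auto simp: eval_nat_numeral less_Suc_eq)
next
  fix u :: complex assume "u \<in> {1, - 1, \<i>, - \<i>}"
  then consider "u = exponents 0" | "u = exponents 5" | "u = exponents 1" | "u = exponents 4" by auto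
  then show "\<exists>i\<in>{..<7}. 0 < ?c i \<and> exponents i = u"
    using assms by cases (intro bexI [of _ 0] bexI [of _ 5] bexI [of _ 1] bexI [of _ 4]; simp)+
qed simp

lemma laurent_exp2:
  assumes "0 < A" "0 < B" "0 \<le> C" "0 \<le> D" "0 < E" "0 < G" "0 \<le> H"
  shows "laurent A B C D E G H (exp2 z) =
    positive_exp_sum.V {..<7::nat} exponents ((!) [A, B, C, D, E, G, H]) z"
proof -
  interpret positive_exp_sum "{..<7::nat}" exponents "(!) [A, B, C, D, E, G, H]"
    by (rule laurent_positive_exp_sum [OF assms])
  have "{..<7::nat} = {0, 1, 2, 3, 4, 5, 6}" by auto
  then show ?thesis
    unfolding V_def
    by (simp add: exp2_def inner_complex_def exp_add exp_diff exp_minus divide_inverse mult_ac)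
qed

lemma log_orbit:
  assumes pos: "\<forall>a\<in>set as. 0 < a" and inv: "laurent_invariant as"
  shows "log_steps as p = p \<or> (\<exists>d T \<tau>. 0 < T \<and>
    (\<forall>t. \<exists>v. v \<noteq> 0 \<and> (d has_vector_derivative v) (at t)) \<and>
    (\<forall>t. d (t + T) = d t) \<and> d 0 = p \<and> (\<forall>t. log_steps as (d t) = d (t + \<tau>)))"
proof -
  obtain A B C D E G H where coef: "0 < A" "0 < B" "0 \<le> C" "0 \<le> D" "0 < E" "0 < G" "0 \<le> H"
    and L: "\<And>x y. 0 < x \<Longrightarrow> 0 < y \<Longrightarrow>
      laurent A B C D E G H (steps as (x, y)) = laurent A B C D E G H (x, y)"
    using laurent_invariantE [OF inv] by metis
  interpret positive_exp_sum "{..<7::nat}" exponents "(!) [A, B, C, D, E, G, H]"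
    by (rule laurent_positive_exp_sum [OF coef])
  have V: "V (log_steps as z) = V z" for z
    unfolding laurent_exp2 [OF coef, symmetric] steps_exp2 [OF pos, symmetric]
    unfolding exp2_def by (rule L) simp_all
  show ?thesis
    using invariant_fixes_minimum [of "log_steps as", OF V]
      invariant_level_rotation [OF area_preserving_log_steps [OF pos] V, of p] by blast
qed

lemma periodic_int:
  assumes "\<And>t. d (t + T) = d (t :: real)"
  shows "d (t + of_int j * T) = d t"
proof -
  have nat: "d (t + of_nat n * T) = d t" for n t
    by (induction n) (use assms [of "t + of_nat _ * T"] in \<open>auto simp: algebra_simps\<close>)
  show ?thesis
  proof (cases "j \<ge> 0")
    case True then show ?thesis using nat [of t "nat j"] by simp
  next
    case False then show ?thesis using nat [of "t + of_int j * T" "nat (- j)"] by simp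
  qed
qed

text \<open>
  Kronecker's theorem: the multiples of \<open>\<tau>\<close> are dense modulo \<open>T\<close>.
\<close>

lemma irrational_orbit_dense:
  fixes g :: "real \<Rightarrow> real"
  assumes "0 < T" "\<tau> / T \<notin> \<rat>" "continuous_on UNIV g" "\<And>t. g (t + T) = g t" "0 < \<epsilon>"
  shows "\<exists>n::nat. \<bar>g (real n * \<tau>) - g t\<bar> < \<epsilon>"
proof -
  have "isCont g t" using assms(3) by (simp add: continuous_on_eq_continuous_at)
  then obtain \<delta> where \<delta>: "0 < \<delta>" "\<And>s. dist s t < \<delta> \<Longrightarrow> dist (g s) (g t) < \<epsilon>"
    using \<open>0 < \<epsilon>\<close> unfolding continuous_at_eps_delta by blast
  have "0 < \<delta> / T" using \<delta>(1) assms(1) by simp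
  then obtain h j where k: "(j::int) > 0" and hj: "\<bar>of_int j * (\<tau> / T) - of_int h - t / T\<bar> < \<delta> / T"
    using sequence_of_fractional_parts_is_dense [OF assms(2)] by metis
  have "of_int j * (\<tau> / T) - of_int h - t / T = ((of_int j * \<tau> + of_int (- h) * T) - t) / T"
    using assms(1) by (simp add: diff_divide_distrib)
  then have "\<bar>(of_int j * \<tau> + of_int (- h) * T) - t\<bar> / T < \<delta> / T"
    using hj assms(1) by simp
  with assms(1) have "dist (of_int j * \<tau> + of_int (- h) * T) t < \<delta>"
    by (simp add: dist_real_def divide_less_cancel)
  then have "dist (g (of_int j * \<tau> + of_int (- h) * T)) (g t) < \<epsilon>" by (rule \<delta>(2))
  then have "\<bar>g (of_int j * \<tau>) - g t\<bar> < \<epsilon>"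
    unfolding periodic_int [of g, OF assms(4)] by (simp add: dist_real_def)
  then show ?thesis using k by (intro exI [of _ "nat j"]) simp
qed

text \<open>
  If the first coordinate were constant, Rolle's theorem for the periodic second coordinate would
  give a point of zero velocity.
\<close>

lemma periodic_curve_coordinate_nonconstant:
  assumes d: "\<And>t. \<exists>v. v \<noteq> 0 \<and> (d has_vector_derivative v) (at t)"
    and "0 < T" "\<And>t. d (t + T) = d (t :: real)"
  shows "\<exists>t. Re (d t) \<noteq> Re (d 0)"
proof (rule ccontr)
  assume "\<not> ?thesis"
  then have const: "(\<lambda>t. Re (d t)) = (\<lambda>t. Re (d 0))" by auto
  obtain v where v: "\<And>t. v t \<noteq> 0" "\<And>t. (d has_vector_derivative v t) (at t)" using d by metis
  have Im: "((\<lambda>t. Im (d t)) has_real_derivative Im (v t)) (at t)" and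
    Re: "((\<lambda>t. Re (d t)) has_real_derivative Re (v t)) (at t)" for t
    using v(2) [of t] by (auto simp: has_vector_derivative_complex_iff)
  have "\<exists>z>0. z < T \<and> Im (d T) - Im (d 0) = (T - 0) * Im (v z)"
    using assms(2) Im by (intro MVT2)
  then obtain z where "Im (v z) = 0" using assms(2) assms(3) [of 0] by auto
  moreover have "Re (v z) = 0" using Re [of z] DERIV_unique [OF _ DERIV_const] unfolding const by blast
  ultimately show False using v(1) by (simp add: complex_eq_iff)
qed

text \<open>
  The intervals are the connected components of the union. Each component contains one of the
  sets \<open>J i\<close>, which bounds their number, and is nondegenerate for the same reason.
\<close>

lemma union_of_intervals:
  fixes J :: "nat \<Rightarrow> real set"
  assumes conn: "\<And>i. i < k \<Longrightarrow> connected (J i)"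
    and nondeg: "\<And>i. i < k \<Longrightarrow> \<exists>u\<in>J i. \<exists>v\<in>J i. u < v"
    and pos: "\<And>i. i < k \<Longrightarrow> J i \<subseteq> {0<..}"
  shows "\<exists>\<I>. finite \<I> \<and> card \<I> \<le> k \<and> disjoint \<I> \<and>
    (\<forall>I\<in>\<I>. is_interval I \<and> interior I \<noteq> {} \<and> I \<subseteq> {0<..}) \<and> \<Union>\<I> = (\<Union>i<k. J i)"
proof -
  define U where "U = (\<Union>i<k. J i)"
  have ex: "\<exists>i<k. J i \<subseteq> C" if C: "C \<in> components U" for C
  proof -
    obtain u where u: "u \<in> C" "u \<in> U" using C in_components_nonempty in_components_subset by blast
    then obtain i where i: "i < k" "u \<in> J i" by (auto simp: U_def)
    then have "J i \<subseteq> C" using components_maximal [OF C conn [OF i(1)]] u(1) by (auto simp: U_def)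
    with i show ?thesis by blast
  qed
  then obtain f where f: "\<And>C. C \<in> components U \<Longrightarrow> f C < k \<and> J (f C) \<subseteq> C" by metis
  have inj: "inj_on f (components U)"
  proof (rule inj_onI)
    fix C C' assume C: "C \<in> components U" "C' \<in> components U" "f C = f C'"
    obtain u where "u \<in> J (f C)" using nondeg f [OF C(1)] by blast
    then have "u \<in> C \<inter> C'" using f [OF C(1)] f [OF C(2)] C(3) by auto
    then show "C = C'" using components_eq [OF C(1,2)] by blast
  qed
  have sub: "f ` components U \<subseteq> {..<k}" using f by auto
  have "finite (components U)" using inj_on_finite [OF inj sub] by simp
  moreover have "card (components U) \<le> k" using card_inj_on_le [OF inj sub] by simp
  moreover have "disjoint (components U)" 
    using pairwise_disjoint_components [of U] by (simp add: pairwise_def disjnt_def)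
  moreover have "is_interval C \<and> interior C \<noteq> {} \<and> C \<subseteq> {0<..}" if C: "C \<in> components U" for C
  proof (intro conjI)
    show int: "is_interval C" using C in_components_connected is_interval_connected_1 by blast
    obtain u v where uv: "u \<in> C" "v \<in> C" "u < v" using nondeg f [OF C] by blast
    have "{u<..<v} \<subseteq> C" using int uv unfolding is_interval_1 by fastforce
    then have "{u<..<v} \<subseteq> interior C" by (simp add: interior_maximal)
    then show "interior C \<noteq> {}" using uv(3) by (metis dense greaterThanLessThan_iff subset_empty empty_iff)
    show "C \<subseteq> {0<..}" using in_components_subset [OF C] pos by (auto simp: U_def)
  qed
  ultimately show ?thesis using Union_components [of U] by (intro exI [of _ "components U"]) (auto simp: U_def)
qed

text \<open>
  A period of the solution is a period of the parameters, because the recurrence expresses the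
  parameters through the solution.
\<close>

lemma periodic_solution:
  assumes unique: "i < length as" "\<And>j. j < length as \<Longrightarrow> as ! j = as ! i \<Longrightarrow> j = i"
    and pos: "\<forall>a\<in>set as. 0 < a"
    and sol: "lyness_solution (cyc as) x" and per: "has_period x q"
  shows "\<exists>p. primitive_period x p \<and> length as dvd p"
proof -
  define p where "p = (LEAST p. has_period x p)"
  have p: "has_period x p" unfolding p_def using per by (rule LeastI)
  have ne: "as \<noteq> []" using unique(1) by auto
  have a: "cyc as n = x (n + 2) * x n - x (Suc n)" if "n \<ge> 1" for n
  proof -
    have "x n \<noteq> 0" using solution_pos [OF pos_seq_cyc [OF ne pos] sol that] by simp
    then show ?thesis using sol that by (auto simp: lyness_solution_def)
  qed
  have "has_period (cyc as) p"
    unfolding has_period_def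
  proof (intro conjI allI impI)
    show "1 \<le> p" using p by (simp add: has_period_def)
    fix n :: nat assume n: "1 \<le> n"
    have "x (j + p) = x j" if "j \<ge> 1" for j using p that by (simp add: has_period_def)
    from this [of n] this [of "Suc n"] this [of "n + 2"] n
    show "cyc as (n + p) = cyc as n" using a [of n] a [of "n + p"] by (simp add: add_ac)
  qed
  moreover have "primitive_period x p"
    unfolding primitive_period_def using p by (auto simp: p_def intro: Least_le)
  ultimately show ?thesis using cyc_period_dvd [OF unique] by blast
qed

text \<open>
  Along a residue class modulo the period, the solution is the continuous periodic function
  \<open>g i\<close> of Hamiltonian time sampled at the multiples of the rotation \<open>\<tau>\<close>.
\<close>

theorem periodic_or_densely_filling_cyc:
  assumes unique: "i < length as" "\<And>j. j < length as \<Longrightarrow> as ! j = as ! i \<Longrightarrow> j = i"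
    and pos: "\<forall>a\<in>set as. 0 < a" and inv: "laurent_invariant as"
  shows "periodic_or_densely_filling (cyc as) (length as)"
  unfolding periodic_or_densely_filling_def
proof (intro allI impI)
  fix x assume sol: "lyness_solution (cyc as) x"
  let ?k = "length as" and ?F = "log_steps as"
  have k: "0 < ?k" using unique(1) by linarith
  define p where "p = Complex (ln (x 1)) (ln (x 2))"
  have p: "exp2 p = (x 1, x 2)" using sol by (simp add: p_def exp2_def lyness_solution_def)
  have pow: "(steps as ^^ n) (x 1, x 2) = exp2 ((?F ^^ n) p)" for n
    by (induction n) (simp_all add: p steps_exp2 [OF pos])
  have x: "x (Suc (n * ?k + i)) = exp (Re (log_steps (take i as) ((?F ^^ n) p)))" if "i < ?k" for n i
  proof -
    have "\<forall>a\<in>set (take i as). 0 < a" using pos by (meson in_set_takeD)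
    then have "(x (Suc (n * ?k + i)), x (Suc (Suc (n * ?k + i)))) =
        exp2 (log_steps (take i as) ((?F ^^ n) p))"
      using solution_steps [OF sol, of i n] that unfolding pow by (simp add: steps_exp2)
    then show ?thesis by (simp add: exp2_def)
  qed
  have decomp: "\<exists>b i. i < ?k \<and> n = Suc (b * ?k + i)" if "n \<ge> 1" for n
    using that k by (intro exI [of _ "(n - 1) div ?k"] exI [of _ "(n - 1) mod ?k"]) simp
  have periodic: "\<exists>p. primitive_period x p \<and> ?k dvd p" if q: "0 < q" "(?F ^^ q) p = p" for q
  proof (rule periodic_solution [OF unique pos sol])
    show "has_period x (q * ?k)"
      unfolding has_period_def
    proof (intro conjI allI impI)
      show "1 \<le> q * ?k" using mult_pos_pos [OF q(1) k] by linarith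
      fix n :: nat assume "1 \<le> n"
      then obtain b i where bi: "i < ?k" "n = Suc (b * ?k + i)" using decomp by blast
      then have "n + q * ?k = Suc ((b + q) * ?k + i)" by (simp add: algebra_simps)
      then have "x (n + q * ?k) = x (Suc ((b + q) * ?k + i))" by (rule arg_cong)
      then show "x (n + q * ?k) = x n"
        unfolding bi(2) x [OF bi(1)] by (simp add: funpow_add q(2))
    qed
  qed
  consider "?F p = p" | d T \<tau> where "0 < T" "\<And>t. \<exists>v. v \<noteq> 0 \<and> (d has_vector_derivative v) (at t)"
      "\<And>t. d (t + T) = d t" "d 0 = p" "\<And>t. ?F (d t) = d (t + \<tau>)"
    using log_orbit [OF pos inv, of p] by metis
  then show "(\<exists>p. primitive_period x p \<and> ?k dvd p) \<or> densely_fills_at_most x ?k"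
  proof cases
    case 1
    then show ?thesis using periodic [of 1] by simp
  next
    case 2
    have iter: "(?F ^^ n) p = d (real n * \<tau>)" for n
      by (induction n) (simp_all add: 2(4,5) algebra_simps)
    show ?thesis
    proof (cases "\<tau> / T \<in> \<rat>")
      case True
      then obtain a b where ab: "b > 0" "\<tau> / T = of_int a / of_int b" by (rule Rats_cases')
      then have "real (nat b) * \<tau> = 0 + of_int a * T" using \<open>0 < T\<close> by (simp add: field_simps)
      then have "(?F ^^ nat b) p = p" using iter [of "nat b"] periodic_int [of d T 0 a] 2(3,4) by simp
      then show ?thesis using periodic [of "nat b"] ab(1) by simp
    next
      case False
      define g where "g = (\<lambda>i t. exp (Re (log_steps (take i as) (d t))))"
      have xg: "x (Suc (n * ?k + i)) = g i (real n * \<tau>)" if "i < ?k" for n i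
        using x [OF that, of n] by (simp add: g_def iter)
      have u: "\<exists>v. v \<noteq> 0 \<and> ((\<lambda>t. log_steps (take i as) (d t)) has_vector_derivative v) (at t)" for i t
      proof -
        have "area_preserving (log_steps (take i as))"
          using pos by (intro area_preserving_log_steps) (meson in_set_takeD)
        then obtain D where D: "(log_steps (take i as) has_derivative D) (at (d t))"
            "\<And>u v. (\<i> * D u) \<bullet> D v = (\<i> * u) \<bullet> v"
          unfolding area_preserving_def by blast
        obtain v where v: "v \<noteq> 0" "(d has_derivative (\<lambda>s. s *\<^sub>R v)) (at t)"
          using 2(2) unfolding has_vector_derivative_def by blast
        have "D v \<noteq> 0" using D(2) [of v] area_form_nondegenerate [of v] v(1) by auto
        then show ?thesis
          using has_derivative_compose [OF v(2) D(1)] linear_cmul [OF has_derivative_linear [OF D(1)]]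
          by (intro exI [of _ "D v"]) (simp add: has_vector_derivative_def)
      qed
      have cont: "continuous_on UNIV (g i)" for i
        unfolding g_def
        by (intro continuous_intros continuous_at_imp_continuous_on ballI)
          (use u has_vector_derivative_continuous in blast)
      have gT: "g i (t + T) = g i t" for i t by (simp add: g_def 2(3))
      obtain \<I> where \<I>: "finite \<I>" "card \<I> \<le> ?k" "disjoint \<I>"
          "\<forall>I\<in>\<I>. is_interval I \<and> interior I \<noteq> {} \<and> I \<subseteq> {0<..}" "\<Union>\<I> = (\<Union>i<?k. range (g i))"
      proof -
        have "connected (range (g i))" for i
          using connected_continuous_image [OF cont] by simp
        moreover have "\<exists>u\<in>range (g i). \<exists>v\<in>range (g i). u < v" for i
        proof -
          obtain t where "g i t \<noteq> g i 0"
            using periodic_curve_coordinate_nonconstant [OF u \<open>0 < T\<close>, of i] 2(3) by (auto simp: g_def)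
          then show ?thesis by (meson linorder_neqE_linordered_idom rangeI)
        qed
        moreover have "range (g i) \<subseteq> {0<..}" for i by (auto simp: g_def)
        ultimately show ?thesis using union_of_intervals [of ?k "\<lambda>i. range (g i)"] that by blast
      qed
      have "x ` {1..} \<subseteq> \<Union>\<I>"
        using decomp xg by (fastforce simp: \<I>(5))
      moreover have "\<Union>\<I> \<subseteq> closure (x ` {1..})"
        unfolding \<I>(5)
      proof clarify
        fix i t assume i: "i < ?k"
        show "g i t \<in> closure (x ` {1..})"
          unfolding closure_approachable
        proof (intro allI impI)
          fix \<epsilon> :: real assume "0 < \<epsilon>"
          then obtain n where "\<bar>g i (real n * \<tau>) - g i t\<bar> < \<epsilon>"
            using irrational_orbit_dense [OF \<open>0 < T\<close> False cont gT] by blast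
          then have "dist (x (Suc (n * ?k + i))) (g i t) < \<epsilon>"
            by (simp add: xg [OF i] dist_real_def)
          then show "\<exists>y\<in>x ` {1..}. dist y (g i t) < \<epsilon>" by auto
        qed
      qed
      ultimately show ?thesis unfolding densely_fills_at_most_def using \<I>(1-4) by blast
    qed
  qed
qed

section \<open>Lists of parameters with a Laurent invariant\<close>

lemma good_cyc:
  assumes as: "as = bs @ v # cs" "v \<notin> set bs" "v \<notin> set cs"
    and pos: "\<forall>a\<in>set as. 0 < a" and inv: "laurent_invariant as"
  shows "good_parameters (cyc as) (length as) (card (set as)) \<and>
    periodic_or_densely_filling (cyc as) (length as)"
proof -
  have ne: "as \<noteq> []" by (simp add: as(1))
  have i: "length bs < length as" by (simp add: as(1))
  have unique: "j = length bs" if "j < length as" "as ! j = as ! length bs" for j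
  proof (cases j "length bs" rule: linorder_cases)
    case less
    then show ?thesis using that as by (metis nth_append nth_append_length nth_mem)
  next
    case greater
    then have "as ! j = cs ! (j - Suc (length bs))" "j - Suc (length bs) < length cs"
      using that(1) by (auto simp: as(1) nth_append nth_Cons')
    then show ?thesis using that(2) as by (metis nth_append_length nth_mem)
  qed
  have "lyness_comp (cyc as) (length as) = steps as"
    using lyness_comp_cyc [of "length as" as] by simp
  moreover have "seq_rank (cyc as) (length as) = card (set as)"
    unfolding seq_rank_def cyc_image ..
  ultimately show ?thesis
    unfolding good_parameters_def
    using pos_seq_cyc [OF ne pos] primitive_cyc [OF i unique] rationally_integrable_steps [OF pos inv]
      persistent_cyc [OF pos inv ne] periodic_or_densely_filling_cyc [OF i unique pos inv]
    by simp
qed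

definition realizable :: "nat \<Rightarrow> nat \<Rightarrow> bool" where
  "realizable k r \<longleftrightarrow> (\<exists>a. good_parameters a k r \<and> periodic_or_densely_filling a k)"

lemma realizableI:
  assumes "laurent_invariant as" "as = bs @ v # cs" "v \<notin> set bs" "v \<notin> set cs"
    and "\<forall>a\<in>set as. 0 < a" "length as = k" "card (set as) = r"
  shows "realizable k r"
  unfolding realizable_def using good_cyc [OF assms(2-5,1)] assms(6,7) by blast

text \<open>
  The invariant of a 6-periodic sequence \<open>a, b, c, d, e, f\<close> of parameters. Its form is forced: if
  the Laurent polynomial after one step is to have the same seven monomials, the numerator
  of the terms with the new coordinate in the denominator must be divisible by \<open>a + y\<close>, and
  comparing coefficients leaves a recurrence for the coefficients of \<open>y / x\<close> which 6-periodicity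
  solves.
\<close>

definition hex :: "real \<Rightarrow> real \<Rightarrow> real \<Rightarrow> real \<Rightarrow> real \<Rightarrow> real \<Rightarrow> real \<times> real \<Rightarrow> real" where
  "hex a b c d e f = laurent c d b e (a + b * f) (f + a * e) (a * f)"

text \<open>
  One step of the recurrence rotates the six parameters. Consequently a composition of maps
  whose parameters have a period dividing six is covered by going once around that period.
\<close>

lemma hex_step:
  assumes "z \<in> Qplus" "0 < a"
  shows "hex b c d e f a (lyness_map a z) = hex a b c d e f z"
proof -
  obtain x y where z: "z = (x, y)" "0 < x" "0 < y" using assms(1) by (auto simp: Qplus_def)
  define w where "w = (a + y) / x"
  have w: "0 < w" "w * x = a + y" using z assms(2) by (simp_all add: w_def)
  have "c * y / w + (b + c * a) / w + b * a / (y * w) = (a + y) * (c * y + b) / (y * w)"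
    using z(3) w(1) by (simp add: field_simps)
  also have "\<dots> = c * x + b * x / y"
    using z w(1) by (simp add: w(2) [symmetric] field_simps)
  finally have 1: "c * y / w + (b + c * a) / w + b * a / (y * w) = c * x + b * x / y" .
  have 2: "e * w + f * w / y = a * e / x + e * y / x + a * f / (x * y) + f / x"
    using z by (simp add: w_def field_simps)
  have "lyness_map a z = (y, w)" by (simp add: z(1) w_def)
  then show ?thesis
    using 1 2 unfolding z(1) hex_def by (simp add: add_divide_distrib)
qed

lemma lyness_map_Qplus: "z \<in> Qplus \<Longrightarrow> 0 < a \<Longrightarrow> lyness_map a z \<in> Qplus"
  by (auto simp: Qplus_def)

lemma laurent_invariant_hexI:
  assumes "0 < a" "0 < b" "0 < c" "0 < d" "0 < e" "0 < f"
    and "\<And>z. z \<in> Qplus \<Longrightarrow> hex a b c d e f (steps as z) = hex a b c d e f z"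
  shows "laurent_invariant as"
  unfolding laurent_invariant_def
proof (intro exI conjI allI impI)
  fix x y :: real assume "0 < x" "0 < y"
  then show "laurent c d b e (a + b * f) (f + a * e) (a * f) (steps as (x, y)) =
      laurent c d b e (a + b * f) (f + a * e) (a * f) (x, y)"
    using assms(7) [of "(x, y)"] by (simp add: hex_def Qplus_def del: laurent.simps)
qed (use assms in \<open>auto intro: add_pos_pos less_imp_le\<close>)

lemma laurent_invariant_periodic_1: "0 < a \<Longrightarrow> laurent_invariant [a]"
  by (rule laurent_invariant_hexI [of a a a a a a]) (simp_all add: hex_step)

lemma laurent_invariant_periodic_2: "0 < a \<Longrightarrow> 0 < b \<Longrightarrow> laurent_invariant [a, b]"
  by (rule laurent_invariant_hexI [of a b a b a b]) (simp_all add: hex_step lyness_map_Qplus)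

lemma laurent_invariant_periodic_3:
  "0 < a \<Longrightarrow> 0 < b \<Longrightarrow> 0 < c \<Longrightarrow> laurent_invariant [a, b, c]"
  by (rule laurent_invariant_hexI [of a b c a b c]) (simp_all add: hex_step lyness_map_Qplus)

lemma laurent_invariant_periodic_6:
  "\<lbrakk>0 < a; 0 < b; 0 < c; 0 < d; 0 < e; 0 < f\<rbrakk> \<Longrightarrow> laurent_invariant [a, b, c, d, e, f]"
  by (rule laurent_invariant_hexI [of a b c d e f]) (simp_all add: hex_step lyness_map_Qplus)

text \<open>
  With \<open>\<lambda> = s, t, t/s, 1/s, 1/t, s/t, s, t, \<dots>\<close>, a solution of
  \<open>\<lambda>\<^sub>n\<^sub>+\<^sub>2 = \<lambda>\<^sub>n\<^sub>+\<^sub>1 / \<lambda>\<^sub>n\<close>, the substitution \<open>x\<^sub>n = \<lambda>\<^sub>n u\<^sub>n\<close> turns the recurrence with constant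
  parameter \<open>1\<close> into the one with parameters \<open>a\<^sub>n = \<lambda>\<^sub>n\<^sub>+\<^sub>1\<close>. As \<open>u\<close> has period \<open>5\<close>, five steps
  multiply the two coordinates by \<open>\<lambda>\<^sub>6 / \<lambda>\<^sub>1 = 1 / t\<close> and \<open>\<lambda>\<^sub>7 / \<lambda>\<^sub>2 = s / t\<close>.
\<close>

definition block :: "real \<Rightarrow> real \<Rightarrow> real list" where
  "block s t = [t, t / s, 1 / s, 1 / t, s / t]"

lemma steps_block_4:
  assumes "0 < s" "0 < t" "0 < x" "0 < y"
  shows "steps [t, t / s, 1 / s, 1 / t] (x, y) = ((x + s) / (s * y), x / t)"
proof -
  have sum: "0 < t + y" "0 < x + s" "0 < t * x + s * (t + y)"
    using assms by (simp_all add: add_pos_pos)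
  \<comment> \<open>The iterates \<open>x\<^sub>4\<close> and \<open>x\<^sub>5\<close>: the factor \<open>t + y\<close> cancels from the latter, which is
    what the relation between the parameters is made for.\<close>
  define x4 where "x4 = (t * x + s * (t + y)) / (s * x * y)"
  define x5 where "x5 = (x + s) / (s * y)"
  have pos: "0 < x4" "0 < x5" using assms sum by (simp_all add: x4_def x5_def)
  have 4: "(t / s + (t + y) / x) / y = x4"
    using assms by (simp add: x4_def field_simps)
  have "1 / s + x4 = (x + s) * (t + y) / (s * x * y)"
    using assms by (simp add: x4_def field_simps)
  then have 5: "(1 / s + x4) / ((t + y) / x) = x5"
    using assms sum by (simp add: x5_def)
  have "1 / t + x5 = (t * x + s * (t + y)) / (s * t * y)"
    using assms by (simp add: x5_def field_simps)
  also have "\<dots> = x / t * x4"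
    using assms by (simp add: x4_def)
  finally have 6: "(1 / t + x5) / x4 = x / t" using pos by simp
  show ?thesis
    unfolding x5_def [symmetric] by (simp only: steps_simps lyness_map_simp 4 5 6 id_apply)
qed

lemma steps_block:
  assumes "0 < s" "0 < t" "0 < x" "0 < y"
  shows "steps (block s t) (x, y) = (x / t, s * y / t)"
proof -
  have "steps (block s t) (x, y) = lyness_map (s / t) (steps [t, t / s, 1 / s, 1 / t] (x, y))"
    by (simp add: block_def)
  also have "\<dots> = (x / t, s * y / t)"
  proof -
    have "s / t + x / t = (x + s) / t" "x + s \<noteq> 0"
      using assms by (simp_all add: add_divide_distrib)
    then show ?thesis unfolding steps_block_4 [OF assms] by simp
  qed
  finally show ?thesis .
qed

lemma laurent_invariant_append:
  assumes "\<And>z. z \<in> Qplus \<Longrightarrow> steps bs z = z" "laurent_invariant as"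
  shows "laurent_invariant (bs @ as)"
  using assms unfolding laurent_invariant_def by (simp add: Qplus_def)

lemma laurent_invariant_Nil: "laurent_invariant []"
  unfolding laurent_invariant_def by (intro exI [of _ 1]) simp

lemma steps_ones: "z \<in> Qplus \<Longrightarrow> steps [1, 1, 1, 1, 1] z = z"
  using steps_block [of 1 1 "fst z" "snd z"] by (auto simp: block_def Qplus_def)

text \<open>
  If the whole composition is the identity, then omitting its last map leaves the inverse of that
  map, which has the same invariants.
\<close>

lemma laurent_invariant_butlast:
  assumes "\<And>z. z \<in> Qplus \<Longrightarrow> steps (as @ [c]) z = z" "\<forall>a\<in>set as. 0 < a" "0 < c"
  shows "laurent_invariant as"
proof (rule laurent_invariant_hexI)
  fix z assume z: "z \<in> Qplus"
  then have "steps as z \<in> Qplus" using steps_pos [OF assms(2)] by (fastforce simp: Qplus_def)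
  then have "hex c c c c c c (lyness_map c (steps as z)) = hex c c c c c c (steps as z)"
    using assms(3) by (rule hex_step)
  then show "hex c c c c c c (steps as z) = hex c c c c c c z" using assms(1) [OF z] by simp
qed (fact assms(3))+

text \<open>
  These are the first four parameters of \<open>block 2 3\<close>, so up to a scaling the composition is the
  inverse of the Lyness map with the remaining parameter \<open>2/3\<close>. The coefficients are proportional
  to those of \<open>hex (2/3) (4/9) (8/9) (8/3) 4 2\<close>, a rescaling of the invariant of a constant
  parameter \<open>4/3\<close> that compensates this scaling.
\<close>

lemma laurent_invariant_4: "laurent_invariant [3, 3/2, 1/2, 1/3]"
  unfolding laurent_invariant_def
proof (intro exI conjI allI impI)
  fix x y :: real assume xy: "0 < x" "0 < y"
  have steps: "steps [3, 3/2, 1/2, 1/3] (x, y) = ((x + 2) / (2 * y), x / 3)"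
    using steps_block_4 [of 2 3 x y] xy by (simp del: steps_simps)
  have "0 < x + 2" using xy by simp
  then show "laurent 4 12 2 18 7 21 6 (steps [3, 3/2, 1/2, 1/3] (x, y)) = laurent 4 12 2 18 7 21 6 (x, y)"
    unfolding steps using xy by (simp add: divide_simps) algebra
qed simp_all

text \<open>
  The list is \<open>block 1 2\<close>, which halves both coordinates, followed by five terms of the
  6-periodic sequence \<open>2, 2, 4, 8, 8, 4\<close>, which rotate its invariant by five places. The rotated
  invariant at a point equals the original one at the halved point, so the whole composition
  preserves it. Two blocks with cancelling scalings would not serve here: their parameters \<open>t\<close>,
  \<open>s\<close>, \<open>t / s\<close> and the inverses of these never take exactly five values.
\<close>

lemma laurent_invariant_10: "laurent_invariant [2, 2, 1, 1/2, 1/2, 2, 2, 4, 8, 8]"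
proof (rule laurent_invariant_hexI [of 4 2 2 4 8 8])
  fix z assume "z \<in> Qplus"
  then obtain x y where z: "z = (x, y)" "0 < x" "0 < y" by (auto simp: Qplus_def)
  have half: "(x / 2, y / 2) \<in> Qplus" using z by (simp add: Qplus_def)
  have "steps [2, 2, 1, 1/2, 1/2, 2, 2, 4, 8, 8] z = steps [2, 2, 4, 8, 8] (x / 2, y / 2)"
    using steps_block [of 1 2 x y] z steps_simps(3) [of "block 1 2" "[2, 2, 4, 8, 8]" "(x, y)"]
    by (simp add: block_def del: steps_simps)
  then have "hex 4 2 2 4 8 8 (steps [2, 2, 1, 1/2, 1/2, 2, 2, 4, 8, 8] z) = hex 2 2 4 8 8 4 (x / 2, y / 2)"
    using half by (simp add: hex_step lyness_map_Qplus del: lyness_map_simp)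
  also have "\<dots> = hex 4 2 2 4 8 8 z"
    by (simp add: hex_def z)
  finally show "hex 4 2 2 4 8 8 (steps [2, 2, 1, 1/2, 1/2, 2, 2, 4, 8, 8] z) = hex 4 2 2 4 8 8 z" .
qed simp_all

section \<open>Periods below fifteen\<close>

text \<open>
  Two blocks with inverse scalings. Their ten parameters take six values, among which
  \<open>2/3\<close> occurs once.
\<close>

definition inverse_blocks :: "real list" where
  "inverse_blocks = block (3/2) 5 @ block (2/3) (1/5)"

lemma steps_inverse_blocks: "z \<in> Qplus \<Longrightarrow> steps inverse_blocks z = z"
  by (auto simp: inverse_blocks_def Qplus_def steps_block)

text \<open>
  Each list is split at a value that occurs once in it; this makes the period primitive. The
  periods \<open>7\<close>, \<open>8\<close>, \<open>9\<close> use the trivial block \<open>1, 1, 1, 1, 1\<close>. In the periods from \<open>11\<close> to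
  \<open>14\<close> exactly one parameter after the two blocks repeats a value of the blocks, which lowers
  the rank to the prescribed one.
\<close>

proposition realizable_small_period:
  assumes "1 \<le> k" "k < 15" "k \<noteq> 5"
  shows "realizable k (small_rank k)"
proof -
  have inv1: "laurent_invariant [1]" "laurent_invariant [5]"
    by (simp_all add: laurent_invariant_periodic_1)
  have inv2: "laurent_invariant [1, 2]" "laurent_invariant [2, 3]" "laurent_invariant [5, 7]"
    by (simp_all add: laurent_invariant_periodic_2)
  have inv3: "laurent_invariant [1, 2, 3]" "laurent_invariant [2, 3, 4]" "laurent_invariant [5, 7, 11]"
    by (simp_all add: laurent_invariant_periodic_3)
  have inv6: "laurent_invariant [1, 2, 3, 4, 5, 6]"
    by (simp add: laurent_invariant_periodic_6)
  have ones: "laurent_invariant ([1, 1, 1, 1, 1] @ as)" if "laurent_invariant as" for as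
    using steps_ones that by (rule laurent_invariant_append)
  have blocks: "laurent_invariant (inverse_blocks @ as)" if "laurent_invariant as" for as
    using steps_inverse_blocks that by (rule laurent_invariant_append)
  have "k = 1 \<or> k = 2 \<or> k = 3 \<or> k = 4 \<or> k = 6 \<or> k = 7 \<or> k = 8 \<or> k = 9 \<or> k = 10 \<or> k = 11 \<or>
      k = 12 \<or> k = 13 \<or> k = 14"
    using assms by arith
  moreover have "realizable 1 (small_rank 1)"
    by (rule realizableI [OF inv1(1), where bs = "[]" and v = "1" and cs = "[]"])
      (simp_all add: small_rank_def)
  moreover have "realizable 2 (small_rank 2)"
    by (rule realizableI [OF inv2(1), where bs = "[]" and v = "1" and cs = "[2]"])
      (simp_all add: small_rank_def)
  moreover have "realizable 3 (small_rank 3)"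
    by (rule realizableI [OF inv3(1), where bs = "[]" and v = "1" and cs = "[2, 3]"])
      (simp_all add: small_rank_def)
  moreover have "realizable 4 (small_rank 4)"
    by (rule realizableI [OF laurent_invariant_4, where bs = "[]" and v = "3" and cs = "[3/2, 1/2, 1/3]"])
      (simp_all add: small_rank_def)
  moreover have "realizable 6 (small_rank 6)"
    by (rule realizableI [OF inv6, where bs = "[]" and v = "1" and cs = "[2, 3, 4, 5, 6]"])
      (simp_all add: small_rank_def)
  moreover have "realizable 7 (small_rank 7)"
    by (rule realizableI [OF ones [OF inv2(2)], where bs = "[1, 1, 1, 1, 1]" and v = "2" and cs = "[3]"])
      (simp_all add: small_rank_def)
  moreover have "realizable 8 (small_rank 8)"
    by (rule realizableI [OF ones [OF inv3(2)], where bs = "[1, 1, 1, 1, 1]" and v = "2" and cs = "[3, 4]"])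
      (simp_all add: small_rank_def)
  moreover have "realizable 9 (small_rank 9)"
    by (rule realizableI [OF ones [OF laurent_invariant_4], where bs = "[1, 1, 1, 1, 1]" and v = "3" and cs = "[3/2, 1/2, 1/3]"])
      (simp_all add: small_rank_def)
  moreover have "realizable 10 (small_rank 10)"
    by (rule realizableI [OF laurent_invariant_10, where bs = "[2, 2]" and v = "1" and cs = "[1/2, 1/2, 2, 2, 4, 8, 8]"])
      (simp_all add: card_insert_if small_rank_def)
  moreover have "realizable 11 (small_rank 11)"
    by (rule realizableI [OF blocks [OF inv1(2)], where bs = "[5, 10/3]" and v = "2/3" and cs = "[1/5, 3/10, 1/5, 3/10, 3/2, 5, 10/3, 5]"])
      (simp_all add: inverse_blocks_def block_def card_insert_if small_rank_def)
  moreover have "realizable 12 (small_rank 12)"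
    by (rule realizableI [OF blocks [OF inv2(3)], where bs = "[5, 10/3]" and v = "2/3" and cs = "[1/5, 3/10, 1/5, 3/10, 3/2, 5, 10/3, 5, 7]"])
      (simp_all add: inverse_blocks_def block_def card_insert_if small_rank_def)
  moreover have "realizable 13 (small_rank 13)"
    by (rule realizableI [OF blocks [OF inv3(3)], where bs = "[5, 10/3]" and v = "2/3" and cs = "[1/5, 3/10, 1/5, 3/10, 3/2, 5, 10/3, 5, 7, 11]"])
      (simp_all add: inverse_blocks_def block_def card_insert_if small_rank_def)
  moreover have "realizable 14 (small_rank 14)"
    by (rule realizableI [OF blocks [OF laurent_invariant_4], where bs = "[5, 10/3]" and v = "2/3" and cs = "[1/5, 3/10, 1/5, 3/10, 3/2, 5, 10/3, 3, 3/2, 1/2, 1/3]"])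
      (simp_all add: inverse_blocks_def block_def card_insert_if small_rank_def)
  ultimately show ?thesis by blast
qed

section \<open>Periods from fifteen on\<close>

text \<open>
  Distinctness of the parameters for large periods reduces to distinctness of pairs of integer
  exponents by unique factorization.
\<close>

definition weight :: "int \<times> int \<Rightarrow> real" where
  "weight = (\<lambda>(i, j). 2 powi i * 3 powi j)"

lemma weight_pos: "0 < weight p"
  by (simp add: weight_def split: prod.split)

lemma power_2_3_eq_1:
  assumes "(2::real) powi i * 3 powi j = 1"
  shows "i = 0 \<and> j = 0"
proof -
  have pow: "m = 0 \<and> n = 0" if "(2::real) ^ m = 3 ^ n" for m n
  proof -
    have eq: "(2::nat) ^ m = 3 ^ n" using that by (metis of_nat_eq_iff of_nat_numeral of_nat_power)
    have "odd ((3::nat) ^ n)" by simp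
    then have "m = 0" unfolding eq [symmetric] by (cases m) auto
    with eq show ?thesis by (cases n) auto
  qed
  have both: "m = 0 \<and> n = 0" if "(2::real) ^ m * 3 ^ n = 1" for m n
  proof -
    have "(2::real) ^ m \<ge> 1" "(3::real) ^ n \<ge> 1" by simp_all
    then have "\<not> (2::real) ^ m > 1" "\<not> (3::real) ^ n > 1"
      using that mult_less_le_imp_less [of 1 "2 ^ m" 1 "3 ^ n :: real"]
        mult_le_less_imp_less [of 1 "2 ^ m" 1 "3 ^ n :: real"] by auto
    then show ?thesis by (metis gr0I one_less_numeral_iff one_less_power semiring_norm(76) semiring_norm(77))
  qed
  show ?thesis
  proof (cases "i \<ge> 0"; cases "j \<ge> 0")
    assume ij: "i \<ge> 0" "j \<ge> 0"
    then show ?thesis using assms both [of "nat i" "nat j"] by (simp add: power_int_def)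
  next
    assume ij: "i \<ge> 0" "\<not> j \<ge> 0"
    then have "(2::real) ^ nat i = 3 ^ nat (- j)" using assms by (simp add: power_int_def field_simps)
    then show ?thesis using pow ij by force
  next
    assume ij: "\<not> i \<ge> 0" "j \<ge> 0"
    then have "(2::real) ^ nat (- i) = 3 ^ nat j" using assms by (simp add: power_int_def field_simps)
    then show ?thesis using pow ij by force
  next
    assume ij: "\<not> i \<ge> 0" "\<not> j \<ge> 0"
    then have "(2::real) ^ nat (- i) * 3 ^ nat (- j) = 1" using assms by (simp add: power_int_def field_simps)
    then show ?thesis using both ij by force
  qed
qed

lemma inj_weight: "inj weight"
proof (rule injI, clarify)
  fix i j i' j' assume "weight (i, j) = weight (i', j')"
  then have "(2::real) powi (i - i') * 3 powi (j - j') = 1"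
    by (simp add: weight_def power_int_diff field_simps)
  from power_2_3_eq_1 [OF this] show "i = i' \<and> j = j'" by simp
qed

text \<open>
  The exponents of \<open>2\<close> and \<open>3\<close> in a block whose scaling is
  \<open>(2 powi (- e), 3 powi (- e))\<close>.
\<close>

definition pair_block :: "int \<Rightarrow> (int \<times> int) list" where
  "pair_block e = [(e, 0), (0, e), (- e, e), (- e, 0), (0, - e)]"

definition chain :: "int list \<Rightarrow> real list" where
  "chain es = map weight (concat (map pair_block es))"

lemma map_weight_pair_block: "map weight (pair_block e) = block ((2 / 3) powi e) (2 powi e)"
  by (simp add: pair_block_def block_def weight_def power_int_divide_distrib power_int_minus field_simps)

lemma steps_chain:
  "0 < x \<Longrightarrow> 0 < y \<Longrightarrow>
    steps (chain es) (x, y) = (x * 2 powi (- sum_list es), y * 3 powi (- sum_list es))"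
proof (induction es arbitrary: x y)
  case Nil then show ?case by (simp add: chain_def)
next
  case (Cons e es)
  have "steps (chain (e # es)) (x, y) = steps (chain es) (steps (block ((2 / 3) powi e) (2 powi e)) (x, y))"
    by (simp add: chain_def map_weight_pair_block)
  also have "\<dots> = steps (chain es) (x / 2 powi e, y / 3 powi e)"
    using Cons.prems by (subst steps_block) (simp_all add: power_int_divide_distrib field_simps)
  also have "\<dots> = (x / 2 powi e * 2 powi (- sum_list es), y / 3 powi e * 3 powi (- sum_list es))"
    using Cons.prems by (intro Cons.IH) simp_all
  finally show ?case by (simp add: power_int_diff power_int_minus field_simps)
qed

text \<open>
  In a single block the five exponent pairs lie on different rays when \<open>e \<noteq> 0\<close>, and
  blocks for numbers of different absolute value share none.
\<close>

lemma distinct_chain: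
  assumes "distinct (map abs es)" "0 \<notin> set es"
  shows "distinct (chain es)"
proof -
  have "distinct (concat (map pair_block es))"
    using assms
  proof (induction es)
    case (Cons e es)
    have "\<bar>e\<bar> \<noteq> \<bar>f\<bar> \<and> f \<noteq> 0" if "f \<in> set es" for f
      using Cons.prems that by auto
    then have "set (pair_block e) \<inter> set (pair_block f) = {}" if "f \<in> set es" for f
      using that Cons.prems by (force simp: pair_block_def)
    with Cons show ?case by (auto simp: pair_block_def)
  qed simp
  then show ?thesis
    unfolding chain_def by (simp add: distinct_map inj_on_subset [OF inj_weight])
qed

lemma length_chain: "length (chain es) = 5 * length es"
  by (induction es) (simp_all add: chain_def pair_block_def)

lemma chain_pos: "\<forall>a\<in>set (chain es). 0 < a"
  by (simp add: chain_def weight_pos)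

text \<open>
  The blocks for \<open>1, \<dots>, n - 1\<close> and for minus their sum have cancelling scalings. The absolute
  value of the last number exceeds the others as soon as \<open>n \<ge> 3\<close>; this is where the bound
  \<open>15\<close> comes from.
\<close>

lemma identity_chain:
  assumes "3 \<le> n"
  shows "\<exists>as. length as = 5 * n \<and> distinct as \<and> (\<forall>a\<in>set as. 0 < a) \<and> (\<forall>z\<in>Qplus. steps as z = z)"
proof -
  define S where "S = sum_list (map int [1..<n])"
  define es where "es = map int [1..<n] @ [- S]"
  have S: "int n \<le> S"
    using assms unfolding S_def
  proof (induction n rule: nat_induct_at_least)
    case base then show ?case by (simp add: upt_conv_Cons)
  qed simp
  have "distinct (map abs es)" using S by (auto simp: es_def distinct_map inj_on_def comp_def)
  moreover have "0 \<notin> set es" using S assms by (auto simp: es_def)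
  ultimately have "distinct (chain es)" by (rule distinct_chain)
  moreover have "sum_list es = 0" by (simp add: es_def S_def)
  then have "\<forall>z\<in>Qplus. steps (chain es) z = z" by (auto simp: Qplus_def steps_chain)
  moreover have "length (chain es) = 5 * n" using assms by (simp add: length_chain es_def)
  ultimately show ?thesis using chain_pos by blast
qed

lemma fresh_positive:
  fixes S :: "real set"
  assumes "finite S"
  shows "\<exists>a>0. a \<notin> S"
proof -
  have "infinite ({0<..} :: real set)" by (simp add: infinite_Ioi)
  then have "\<not> {0<..} \<subseteq> S" using assms finite_subset by blast
  then show ?thesis by auto
qed

text \<open>
  Write \<open>k = 5 n + r\<close>. For \<open>r \<le> 3\<close>, \<open>r\<close> fresh parameters are appended to \<open>n\<close> blocks composing
  to the identity; for \<open>r = 4\<close>, the last parameter of \<open>n + 1\<close> such blocks is dropped.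
\<close>

lemma large_list:
  assumes "15 \<le> k"
  shows "\<exists>as. length as = k \<and> distinct as \<and> (\<forall>a\<in>set as. 0 < a) \<and> laurent_invariant as"
proof (cases "k mod 5 = 4")
  case True
  have "3 \<le> k div 5" using assms by arith
  obtain as where as: "length as = 5 * (k div 5 + 1)" "distinct as" "\<forall>a\<in>set as. 0 < a"
      "\<forall>z\<in>Qplus. steps as z = z"
    using identity_chain [of "k div 5 + 1"] \<open>3 \<le> k div 5\<close> by (metis le_add1 order_trans)
  have ne: "as \<noteq> []" using as(1) by auto
  have eq: "as = butlast as @ [last as]" using ne by simp
  have "laurent_invariant (butlast as)"
    using as(3,4) ne by (intro laurent_invariant_butlast [of _ "last as"]) (auto dest: in_set_butlastD)
  moreover have "length (butlast as) = k" using as(1) True by (simp, presburger)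
  ultimately show ?thesis
    using as(2,3) by (intro exI [of _ "butlast as"]) (auto simp: distinct_butlast dest: in_set_butlastD)
next
  case False
  have "3 \<le> k div 5" using assms by arith
  obtain as where as: "length as = 5 * (k div 5)" "distinct as" "\<forall>a\<in>set as. 0 < a"
      "\<forall>z\<in>Qplus. steps as z = z"
    using identity_chain [OF \<open>3 \<le> k div 5\<close>] by metis
  obtain a where a: "0 < a" "a \<notin> set as" using fresh_positive [of "set as"] by auto
  obtain b where b: "0 < b" "b \<notin> insert a (set as)" using fresh_positive [of "insert a (set as)"] by auto
  obtain c where c: "0 < c" "c \<notin> insert b (insert a (set as))"
    using fresh_positive [of "insert b (insert a (set as))"] by auto
  have "k mod 5 < 5" by simp
  with False consider "k mod 5 = 0" | "k mod 5 = 1" | "k mod 5 = 2" | "k mod 5 = 3" by linarith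
  then obtain bs where bs: "length bs = k mod 5" "laurent_invariant bs" "distinct bs"
      "set bs \<inter> set as = {}" "\<forall>b\<in>set bs. 0 < b"
  proof cases
    case 1 then show ?thesis using that [of "[]"] laurent_invariant_Nil by simp
  next
    case 2 then show ?thesis using that [of "[a]"] laurent_invariant_periodic_1 a by simp
  next
    case 3 then show ?thesis using that [of "[a, b]"] laurent_invariant_periodic_2 a b by simp
  next
    case 4 then show ?thesis using that [of "[a, b, c]"] laurent_invariant_periodic_3 a b c by simp
  qed
  then show ?thesis
    using as laurent_invariant_append [of as bs] by (intro exI [of _ "as @ bs"]) auto
qed

proposition realizable_large_period:
  assumes "15 \<le> k"
  shows "realizable k k"
proof -
  obtain as where as: "length as = k" "distinct as" "\<forall>a\<in>set as. 0 < a" "laurent_invariant as"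
    using large_list [OF assms] by blast
  then obtain v cs where "as = v # cs" using assms by (cases as) auto
  then show ?thesis
    using as by (intro realizableI [of as "[]" v cs]) (auto simp: distinct_card)
qed

theorem theorem19:
  shows "(\<forall>k\<ge>15. \<exists>a. good_parameters a k k) \<and>
    (\<forall>k. 1 \<le> k \<and> k < 15 \<and> k \<noteq> 5 \<longrightarrow> (\<exists>a. good_parameters a k (small_rank k))) \<and>
    (\<forall>k\<ge>15. \<exists>a. good_parameters a k k \<and> periodic_or_densely_filling a k) \<and>
    (\<forall>k. 1 \<le> k \<and> k < 15 \<and> k \<noteq> 5 \<longrightarrow>
       (\<exists>a. good_parameters a k (small_rank k) \<and> periodic_or_densely_filling a k))"
  using realizable_small_period realizable_large_period unfolding realizable_def by blast

end
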